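(* Let $X_1,\dots,X_n$ be i.i.d. random variables with common density $s_\star$ with respect to the Lebesgue measure $\mu$, with $s_\star\in L^2(\mu)$, and let $S\subset L^2(\mu)$ be a linear space of measurable functions. Let $\delta>0$ be such that $\lceil\ln(\delta^{-2})\rceil\le n/2$. Let $V=\lceil\ln(\delta^{-2})\rceil\vee8$, assume $V\le n/2$, and let $\mathcal B=(B_1,\dots,B_V)$ be a regular partition of $\{1,\dots,n\}$. For all $K=1,\dots,V$ let $\hat s_K=\arg\min_{t\in S}P_{B_K}\gamma(t)$, where $\gamma(t)=\|t\|^2-2t$, and let $\hat s_{K_\star}$ be the estimator with $$K_\star\in\arg\min_{K=1,\dots,V}\ \max_{K'=1,\dots,V}\left\{\overline P_{K,K'}\left(\gamma(\hat s_K)-\gamma(\hat s_{K'})\right)\right\}.$$ Then, for $L_5=2\sqrt e+8L_1e^{1/4}$, $$\mathbb P\left(\|\hat s_{K_\star}-s_\star\|^2>\|s_o-s_\star\|^2+L_5\left(P\Psi-\|s_o\|^2\right)\frac Vn\right)\le2\delta .$$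
   Context: $\|\cdot\|$ is the norm of $L^2(\mu)$; $Pt=\int t\,s_\star\,d\mu$; $s_o$ is the orthogonal projection of $s_\star$ onto $S$; $\Psi=\sup\{t^2:\ t\in S,\ \|t\|\le1\}$ pointwise, equivalently $\Psi=\sum_\lambda\psi_\lambda^2$ for an orthonormal basis $(\psi_\lambda)$ of $S$. (For an orthonormal basis, $\hat s_K=\sum_\lambda(P_{B_K}\psi_\lambda)\psi_\lambda$.) A partition $(B_1,\dots,B_V)$ of $\{1,\dots,n\}$ is regular if $|\mathrm{Card}(B_K)-n/V|\le1$ for all $K$. $P_{B_J}t=\frac1{\mathrm{Card}(B_J)}\sum_{i\in B_J}t(X_i)$ and $\overline P_{K,K'}t=\mathrm{Med}\{P_{B_J}t:\ J\ne K,K'\}$, where $\mathrm{Med}(a_1,\dots,a_N)$ is any real $b$ with $\mathrm{Card}\{i: a_i\le b\}\ge N/2$ and $\mathrm{Card}\{i:a_i\ge b\}\ge N/2$. $L_1=\sqrt{2/r}$ with $r=(1-\sqrt{1-e^{-2}})/2$ (so $L_1\le2\sqrt{6e}$). $a\vee b=\max(a,b)$. *)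

theory Defs
  imports "HOL-Probability.Probability"
begin

definition L2 :: "'a measure \<Rightarrow> ('a \<Rightarrow> real) set" where
  "L2 \<mu> = {f \<in> borel_measurable \<mu>. integrable \<mu> (\<lambda>x. (f x)\<^sup>2)}"

definition norm2 :: "'a measure \<Rightarrow> ('a \<Rightarrow> real) \<Rightarrow> real" where
  "norm2 \<mu> f = sqrt (\<integral>x. (f x)\<^sup>2 \<partial>\<mu>)"

text \<open>Elements of \<open>S\<close> are genuine functions, not classes modulo null sets: the empirical
  means evaluate them at the observations. Functions are not an instance of the class of real
  vector spaces, so the subspace conditions are spelled out.\<close>

definition linear_space_of_functions :: "('a \<Rightarrow> real) set \<Rightarrow> bool" where
  "linear_space_of_functions S \<longleftrightarrow>
     (\<lambda>x. 0) \<in> S \<and>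
     (\<forall>f\<in>S. \<forall>g\<in>S. (\<lambda>x. f x + g x) \<in> S) \<and>
     (\<forall>c. \<forall>f\<in>S. (\<lambda>x. c * f x) \<in> S)"

definition is_orth_proj :: "'a measure \<Rightarrow> ('a \<Rightarrow> real) set \<Rightarrow> ('a \<Rightarrow> real) \<Rightarrow> ('a \<Rightarrow> real) \<Rightarrow> bool" where
  "is_orth_proj \<mu> S f g \<longleftrightarrow> g \<in> S \<and> (\<forall>t\<in>S. (\<integral>x. (f x - g x) * t x \<partial>\<mu>) = 0)"

text \<open>Both \<open>\<Psi>\<close> and its mean are extended-valued: if \<open>S\<close> is infinite dimensional they may be
  infinite. The mean is \<open>P\<Psi> = \<integral>\<Psi> s d\<mu>\<close> for the density \<open>s\<close>.\<close>

definition Psi :: "'a measure \<Rightarrow> ('a \<Rightarrow> real) set \<Rightarrow> 'a \<Rightarrow> ennreal" where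
  "Psi \<mu> S x = (SUP t\<in>{t\<in>S. norm2 \<mu> t \<le> 1}. ennreal ((t x)\<^sup>2))"

definition P_Psi :: "'a measure \<Rightarrow> ('a \<Rightarrow> real) \<Rightarrow> ('a \<Rightarrow> real) set \<Rightarrow> ennreal" where
  "P_Psi \<mu> s S = (\<integral>\<^sup>+x. Psi \<mu> S x * ennreal (s x) \<partial>\<mu>)"

definition contrast :: "'a measure \<Rightarrow> ('a \<Rightarrow> real) \<Rightarrow> 'a \<Rightarrow> real" where
  "contrast \<mu> t x = (norm2 \<mu> t)\<^sup>2 - 2 * t x"

definition emp_mean :: "(nat \<Rightarrow> 'w \<Rightarrow> 'a) \<Rightarrow> nat set \<Rightarrow> 'w \<Rightarrow> ('a \<Rightarrow> real) \<Rightarrow> real" where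
  "emp_mean X A \<omega> t = (\<Sum>i\<in>A. t (X i \<omega>)) / real (card A)"

definition regular_partition :: "nat \<Rightarrow> nat \<Rightarrow> (nat \<Rightarrow> nat set) \<Rightarrow> bool" where
  "regular_partition n V B \<longleftrightarrow>
     (\<Union>K\<in>{1..V}. B K) = {1..n} \<and> disjoint_family_on B {1..V} \<and>
     (\<forall>K\<in>{1..V}. \<bar>real (card (B K)) - real n / real V\<bar> \<le> 1)"

text \<open>A median of a finite family need not be unique, hence a predicate rather than a function.\<close>

definition is_median :: "'i set \<Rightarrow> ('i \<Rightarrow> real) \<Rightarrow> real \<Rightarrow> bool" where
  "is_median I a b \<longleftrightarrow>
     real (card {i\<in>I. a i \<le> b}) \<ge> real (card I) / 2 \<and>
     real (card {i\<in>I. a i \<ge> b}) \<ge> real (card I) / 2"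

definition L1_const :: real where
  "L1_const = sqrt (2 / ((1 - sqrt (1 - exp (- 2))) / 2))"

definition L5_const :: real where
  "L5_const = 2 * sqrt (exp 1) + 8 * L1_const * exp (1 / 4)"

end

theory Submission
  imports Defs
begin

text \<open>
  Put \<open>a\<^sub>J = s\<^sub>J - s\<^sub>o\<close> for the projection estimator \<open>s\<^sub>J\<close> of the block \<open>B\<^sub>J\<close>, and \<open>e\<^sub>J = \<parallel>a\<^sub>J\<parallel>\<close>. The median
  criterion compares two estimators through
  \<open>e\<^sub>K\<^sup>2 - e\<^sub>K'\<^sup>2 - 2 \<langle>a\<^sub>J, a\<^sub>K - a\<^sub>K'\<rangle>\<close>, which Cauchy--Schwarz controls by the \<open>e\<^sub>J\<close> alone. Hence no
  union bound over pairs is needed: if fewer than \<open>V/2 - 1\<close> of the \<open>e\<^sub>J\<close> exceed \<open>\<eta>\<close>, then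
  \<open>e\<^sub>*\<close> is at most \<open>(1 + \<surd>2) \<eta> + \<surd>2 min\<^sub>J e\<^sub>J\<close>.

  With \<open>u\<^sup>2 = (P\<Psi> - \<parallel>s\<^sub>o\<parallel>\<^sup>2) V/n\<close>, this makes \<open>e\<^sub>*\<^sup>2 > L\<^sub>5 u\<^sup>2\<close> force
  \<open>\<Prod>\<^sub>J (1 + (3/4) e\<^sub>J\<^sup>2 / u\<^sup>2) \<ge> 2\<^sup>V e\<^bsup>V/2\<^esup> / 2\<close>. The factors are independent, and
  \<open>E e\<^sub>J\<^sup>2 \<le> (P\<Psi> - \<parallel>s\<^sub>o\<parallel>\<^sup>2) / Card(B\<^sub>J)\<close>, so the product has mean at most \<open>2\<^sup>V\<close>; Markov's inequality
  bounds the probability of failure by \<open>2 e\<^bsup>-V/2\<^esup> \<le> 2 \<delta>\<close>.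

  As \<open>S\<close> may be infinite dimensional and incomplete, and its elements are functions rather than
  classes, \<open>e\<^sub>J\<^sup>2\<close> is identified almost surely with a measurable series along a Gram--Schmidt
  sequence of a countable dense subset of \<open>S\<close>. Only the partial sums of \<open>\<Sum>\<psi>\<^sub>k\<^sup>2 \<le> \<Psi>\<close> are
  integrated, so that \<open>\<Psi>\<close> itself need not be measurable.
\<close>

subsection \<open>The selection rule\<close>

text \<open>At least half of the indices satisfy \<open>a i \<ge> b\<close> and the bad ones are a
  strict minority, so some good index has \<open>b \<le> a i \<le> c\<close>.\<close>

lemma median_le_of_good:
  assumes "is_median I a b" "finite I" "2 * card {i \<in> I. bad i} < card I"
    and "\<And>i. i \<in> I \<Longrightarrow> \<not> bad i \<Longrightarrow> a i \<le> c"
  shows "b \<le> c"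
proof (rule ccontr)
  assume "\<not> b \<le> c"
  then have "{i \<in> I. a i \<ge> b} \<subseteq> {i \<in> I. bad i}"
    using assms(4) by force
  then have "card {i \<in> I. a i \<ge> b} \<le> card {i \<in> I. bad i}"
    using assms(2) by (intro card_mono) auto
  then show False
    using assms(1,3) unfolding is_median_def by linarith
qed

lemma median_ge_of_good:
  assumes "is_median I a b" "finite I" "2 * card {i \<in> I. bad i} < card I"
    and "\<And>i. i \<in> I \<Longrightarrow> \<not> bad i \<Longrightarrow> c \<le> a i"
  shows "c \<le> b"
proof (rule ccontr)
  assume "\<not> c \<le> b"
  then have "{i \<in> I. a i \<le> b} \<subseteq> {i \<in> I. bad i}"
    using assms(4) by force
  then have "card {i \<in> I. a i \<le> b} \<le> card {i \<in> I. bad i}"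
    using assms(2) by (intro card_mono) auto
  then show False
    using assms(1,3) unfolding is_median_def by linarith
qed

text \<open>The criterion at \<open>Ko\<close> is at most \<open>(e Ko + \<eta>)\<^sup>2\<close>.
  Minimality passes this bound on to \<open>Ks\<close>, whose criterion is bounded from below
  through its comparison with \<open>Ko\<close> alone.\<close>

lemma minmax_median_selection_bound:
  fixes e :: "'i \<Rightarrow> real" and I :: "'i set"
  assumes fin: "finite I"
    and e_nonneg: "\<And>K. K \<in> I \<Longrightarrow> 0 \<le> e K"
    and med: "\<And>K K'. K \<in> I \<Longrightarrow> K' \<in> I \<Longrightarrow> is_median (I - {K, K'}) (v K K') (Pb K K')"
    and v: "\<And>K K' J. K \<in> I \<Longrightarrow> K' \<in> I \<Longrightarrow> J \<in> I \<Longrightarrow>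
      \<bar>v K K' J - ((e K)\<^sup>2 - (e K')\<^sup>2)\<bar> \<le> 2 * e J * (e K + e K')"
    and Ks: "is_arg_min (\<lambda>K. MAX K'\<in>I. Pb K K') (\<lambda>K. K \<in> I) Ks"
    and Ko: "Ko \<in> I"
    and few: "2 * card {J \<in> I. \<eta> < e J} + 2 < card I"
  shows "e Ks \<le> (1 + sqrt 2) * \<eta> + sqrt 2 * e Ko"
proof -
  have KsI: "Ks \<in> I" using Ks by (simp add: is_arg_min_def)
  have eta: "0 \<le> \<eta>"
  proof (rule ccontr)
    assume "\<not> 0 \<le> \<eta>"
    then have "{J \<in> I. \<eta> < e J} = I" using e_nonneg by force
    then show False using few by simp
  qed
  \<comment> \<open>Leaving out \<open>K\<close> and \<open>K'\<close> costs at most two indices,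
    hence the \<open>+ 2\<close> in \<open>few\<close>.\<close>
  have few': "2 * card {J \<in> I - {K, K'}. \<eta> < e J} < card (I - {K, K'})" for K K'
  proof -
    have "card {J \<in> I - {K, K'}. \<eta> < e J} \<le> card {J \<in> I. \<eta> < e J}"
      using fin by (intro card_mono) auto
    moreover have "card I \<le> card (I - {K, K'}) + 2"
    proof -
      have "card {K, K'} \<le> 2" by (simp add: card_insert_if)
      then show ?thesis using diff_card_le_card_Diff[of "{K, K'}" I] by simp
    qed
    ultimately show ?thesis using few by linarith
  qed
  have up: "Pb Ko K' \<le> (e Ko + \<eta>)\<^sup>2" if K': "K' \<in> I" for K'
  proof (rule median_le_of_good[OF med[OF Ko K'] _ few'])
    show "finite (I - {Ko, K'})" using fin by simp
    fix J assume J: "J \<in> I - {Ko, K'}" "\<not> \<eta> < e J"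
    have "v Ko K' J \<le> (e Ko)\<^sup>2 - (e K')\<^sup>2 + 2 * e J * (e Ko + e K')"
      using v[OF Ko K', of J] J by auto
    also have "\<dots> \<le> (e Ko)\<^sup>2 - (e K')\<^sup>2 + 2 * \<eta> * (e Ko + e K')"
      using J e_nonneg[OF Ko] e_nonneg[OF K'] by (intro add_left_mono mult_right_mono) auto
    \<comment> \<open>Completing the square in \<open>e K'\<close> makes the bound uniform in the
      competitor.\<close>
    also have "\<dots> \<le> (e Ko + \<eta>)\<^sup>2"
      using zero_le_power2[of "e K' - \<eta>"] by (simp add: power2_eq_square algebra_simps)
    finally show "v Ko K' J \<le> (e Ko + \<eta>)\<^sup>2" .
  qed
  have lo: "(e Ks)\<^sup>2 - (e Ko)\<^sup>2 - 2 * \<eta> * (e Ks + e Ko) \<le> Pb Ks Ko"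
  proof (rule median_ge_of_good[OF med[OF KsI Ko] _ few'])
    show "finite (I - {Ks, Ko})" using fin by simp
    fix J assume J: "J \<in> I - {Ks, Ko}" "\<not> \<eta> < e J"
    have "(e Ks)\<^sup>2 - (e Ko)\<^sup>2 - 2 * \<eta> * (e Ks + e Ko) \<le> (e Ks)\<^sup>2 - (e Ko)\<^sup>2 - 2 * e J * (e Ks + e Ko)"
      using J e_nonneg[OF Ko] e_nonneg[OF KsI] by (intro diff_left_mono mult_right_mono) auto
    also have "\<dots> \<le> v Ks Ko J" using v[OF KsI Ko, of J] J by auto
    finally show "(e Ks)\<^sup>2 - (e Ko)\<^sup>2 - 2 * \<eta> * (e Ks + e Ko) \<le> v Ks Ko J" .
  qed
  have "Pb Ks Ko \<le> (MAX K'\<in>I. Pb Ks K')"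
    using fin Ko by (intro Max_ge) auto
  also have "\<dots> \<le> (MAX K'\<in>I. Pb Ko K')"
    using Ks Ko by (auto simp: is_arg_min_def not_less)
  also have "\<dots> \<le> (e Ko + \<eta>)\<^sup>2"
    using fin Ko up by (subst Max_le_iff) auto
  \<comment> \<open>Adding \<open>\<eta>\<^sup>2\<close> and moving the terms in \<open>e Ko\<close>
    to the right turns both sides into squares.\<close>
  finally have "(e Ks - \<eta>)\<^sup>2 \<le> 2 * (e Ko + \<eta>)\<^sup>2"
    using lo by (simp add: power2_eq_square algebra_simps)
  also have "\<dots> = (sqrt 2 * (e Ko + \<eta>))\<^sup>2" by (simp add: power_mult_distrib)
  finally have "e Ks - \<eta> \<le> sqrt 2 * (e Ko + \<eta>)"
    by (rule power2_le_imp_le) (use eta e_nonneg[OF Ko] in auto)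
  then show ?thesis by (simp add: algebra_simps)
qed

section \<open>Numerical constants and the cost of a failed selection\<close>

lemma exp1_bounds: "2.718 < exp (1::real)" "exp (1::real) < 2.7183"
  using e_approx_32 by (auto simp: abs_if split: if_splits)

text \<open>The threshold \<open>\<eta> = 3.72 - 0.586 x\<close> is a rational lower approximation of the solution of
  \<open>(1 + \<surd>2) \<eta> + \<surd>2 x = \<surd>80.66\<close>, and \<open>80.66 \<le> L\<^sub>5\<close>.\<close>

lemma quartic_bound:
  fixes x :: real
  assumes "0 \<le> x" "x \<le> (23/10)"
  shows "4 * exp 1 \<le> (1 + 3/4 * ((93/25) - (293/500) * x)\<^sup>2) * (1 + 3/4 * x\<^sup>2)"
proof -
  \<comment> \<open>This cubic is the expanded product minus \<open>27187/2500\<close>, with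
    coefficients rounded down and the \<open>x ^ 4\<close> term dropped; \<open>27187/2500\<close>
    slightly exceeds \<open>4 * exp 1\<close>. On either side of \<open>x = 1\<close> the factor of
    \<open>x\<^sup>2\<close> is replaced by a constant lower bound, which leaves a
    quadratic.\<close>
  have "0 \<le> (63/125) - (327/100) * x + ((879/100) - (2453/1000) * x) * x\<^sup>2"
  proof (cases "x \<le> 1")
    case True
    have "0 \<le> (63/125) - (327/100) * x + (633/100) * x\<^sup>2"
      using zero_le_power2[of "x - (327/100)/(633/50)"] by (simp add: power2_eq_square field_simps)
    also have "\<dots> \<le> (63/125) - (327/100) * x + ((879/100) - (2453/1000) * x) * x\<^sup>2"
      using True by (intro add_left_mono mult_right_mono) auto
    finally show ?thesis .
  next
    case False
    have "0 \<le> (x - 1) * ((31/10) * x - (1/10))" using False by (intro mult_nonneg_nonneg) auto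
    also have "(x - 1) * ((31/10) * x - (1/10)) = (31/10) * x\<^sup>2 - (16/5) * x + (1/10)"
      by (simp add: power2_eq_square field_simps)
    finally have "0 \<le> (63/125) - (327/100) * x + (31/10) * x\<^sup>2"
      using assms by simp
    also have "\<dots> \<le> (63/125) - (327/100) * x + ((879/100) - (2453/1000) * x) * x\<^sup>2"
      using assms by (intro add_left_mono mult_right_mono) auto
    finally show ?thesis .
  qed
  also have "\<dots> \<le> (1 + 3/4 * ((93/25) - (293/500) * x)\<^sup>2) * (1 + 3/4 * x\<^sup>2) - (27187/2500)"
  proof -
    have "(1 + 3/4 * ((93/25) - (293/500) * x)\<^sup>2) * (1 + 3/4 * x\<^sup>2) =
        (28447/2500) - (81747/25000) * x + (8791647/1000000) * x\<^sup>2 - (245241/100000) * x ^ 3 + (772641/4000000) * x ^ 4"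
      by (simp add: power2_eq_square power3_eq_cube power4_eq_xxxx field_simps)
    moreover have "((879/100) - (2453/1000) * x) * x\<^sup>2 = (879/100) * x\<^sup>2 - (2453/1000) * x ^ 3"
      by (simp add: power2_eq_square power3_eq_cube field_simps)
    moreover have "0 \<le> x\<^sup>2" "0 \<le> x ^ 3" "0 \<le> x ^ 4" using assms by auto
    ultimately show ?thesis using assms by linarith
  qed
  finally show ?thesis using exp1_bounds(2) by simp
qed

text \<open>The rest of the proof sees \<open>L5_const\<close> only through this rational bound,
  which combines \<open>sqrt (exp 1) \<ge> 1.648\<close>, \<open>L1_const \<ge> 7.54\<close> and
  \<open>exp (1/4) \<ge> 1.283\<close>.\<close>

lemma L5_const_lower: "80.66 \<le> L5_const"
proof -
  define h where "h = exp (1/4 :: real)"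
  have h4: "h ^ 4 = exp 1" unfolding h_def by (simp flip: exp_of_nat_mult)
  have h0: "0 < h" by (simp add: h_def)
  have h: "1.283 \<le> h"
  proof (rule ccontr)
    assume "\<not> 1.283 \<le> h"
    then have "h ^ 4 \<le> 1.283 ^ 4" using h0 by (intro power_mono) auto
    then show False using h4 exp1_bounds(1) by (simp add: power4_eq_xxxx)
  qed
  have s: "1.648 \<le> sqrt (exp 1)"
    using exp1_bounds(1) by (intro real_le_rsqrt) (simp add: power2_eq_square)
  \<comment> \<open>\<open>L1_const\<close> decreases in \<open>exp (-2)\<close>, so an upper bound
    is wanted here.\<close>
  have "exp (-2::real) = 1 / (exp 1)\<^sup>2"
    by (simp add: exp_minus inverse_eq_divide flip: exp_of_nat_mult)
  also have "\<dots> \<le> 1 / 2.718\<^sup>2"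
    using exp1_bounds(1) by (intro divide_left_mono power_mono mult_pos_pos) auto
  also have "\<dots> \<le> 0.1354" by (simp add: power2_eq_square)
  finally have e2: "exp (-2::real) \<le> 0.1354" .
  have q: "0.9298 \<le> sqrt (1 - exp (-2))"
    using e2 by (intro real_le_rsqrt) (simp add: power2_eq_square)
  have q1: "sqrt (1 - exp (-2)) < 1" by simp
  have "56.9 * ((1 - sqrt (1 - exp (-2))) / 2) \<le> 2" using q by simp
  then have "56.9 \<le> 2 / ((1 - sqrt (1 - exp (-2))) / 2)"
    using q q1 by (subst pos_le_divide_eq) auto
  then have L1: "7.54 \<le> L1_const"
    unfolding L1_const_def by (intro real_le_rsqrt) (simp add: power2_eq_square)
  have "7.54 * 1.283 \<le> L1_const * h"
    using L1 h by (intro mult_mono) auto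
  then show ?thesis
    using s unfolding L5_const_def h_def by simp
qed

text \<open>The factor of \<open>k\<close> is at least \<open>a\<close>, the others of
  \<open>B\<close> at least \<open>h\<close>, all remaining ones at least \<open>l\<close>. As
  \<open>B\<close> holds almost half of \<open>I\<close>, factors \<open>h\<close> and
  \<open>l\<close> can be paired off; squaring avoids half-integer exponents.\<close>

lemma prod_power_split_lower:
  fixes f :: "'i \<Rightarrow> real"
  assumes "finite I" "B \<subseteq> I" "k \<in> B" and l: "1 \<le> l" "l \<le> h"
    and "a \<le> f k" "0 \<le> a"
    and "\<And>i. i \<in> B \<Longrightarrow> h \<le> f i" "\<And>i. i \<in> I \<Longrightarrow> l \<le> f i"
    and "4 \<le> card I" "card I \<le> 2 * card B + 2"
  shows "a\<^sup>2 * (h * l) ^ (card I - 4) \<le> (\<Prod>i\<in>I. f i)\<^sup>2"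
proof -
  have finB: "finite B" using assms(1,2) finite_subset by blast
  have cB: "card B \<ge> 1" "card B \<le> card I"
    using finB assms(3) assms(1,2) by (auto simp: Suc_le_eq card_gt_0_iff card_mono)
  have "(\<Prod>i\<in>I. f i) = f k * (\<Prod>i\<in>B - {k}. f i) * (\<Prod>i\<in>I - B. f i)"
    using prod.subset_diff[OF assms(2,1), of f] prod.remove[OF finB assms(3), of f] by simp
  also have "\<dots> \<ge> a * h ^ (card B - 1) * l ^ (card I - card B)"
  proof -
    have "h ^ (card B - 1) = (\<Prod>i\<in>B - {k}. h)" using finB assms(3) by simp
    also have "\<dots> \<le> (\<Prod>i\<in>B - {k}. f i)" using assms l by (intro prod_mono) auto
    finally have 1: "h ^ (card B - 1) \<le> (\<Prod>i\<in>B - {k}. f i)" .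
    have "l ^ (card I - card B) = (\<Prod>i\<in>I - B. l)"
      using assms(1,2) finB by (simp add: card_Diff_subset)
    also have "\<dots> \<le> (\<Prod>i\<in>I - B. f i)" using assms l by (intro prod_mono) auto
    finally have 2: "l ^ (card I - card B) \<le> (\<Prod>i\<in>I - B. f i)" .
    have 3: "0 \<le> (\<Prod>i\<in>B - {k}. f i)" using 1 l by (smt (verit) zero_le_power)
    show ?thesis using 1 2 3 assms(6,7) l
      by (intro mult_mono) auto
  qed
  finally have main: "a * h ^ (card B - 1) * l ^ (card I - card B) \<le> (\<Prod>i\<in>I. f i)" .
  \<comment> \<open>\<open>c\<close> counts the factors \<open>h\<close> in excess of
    \<open>card I - 4\<close>. Lowered to \<open>l\<close>, they fill up the powers of
    \<open>l\<close> and leave six over, each at least 1.\<close>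
  define c where "c = 2 * card B + 2 - card I"
  have c: "2 * (card B - 1) = (card I - 4) + c" "2 * (card I - card B) + c = (card I - 4) + 6"
    using assms(10,11) cB by (auto simp: c_def)
  have "(h * l) ^ (card I - 4) \<le> (h * l) ^ (card I - 4) * l ^ 6"
    using l mult_left_mono[of 1 "l ^ 6" "(h * l) ^ (card I - 4)"] by (simp add: one_le_power)
  also have "\<dots> = h ^ (card I - 4) * l ^ (2 * (card I - card B) + c)"
    unfolding c(2) by (simp add: power_mult_distrib power_add)
  also have "\<dots> \<le> h ^ (card I - 4) * (l ^ (2 * (card I - card B)) * h ^ c)"
    unfolding power_add using l by (intro mult_left_mono power_mono) auto
  also have "\<dots> = h ^ (2 * (card B - 1)) * l ^ (2 * (card I - card B))"
    unfolding c(1) by (simp add: power_add)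
  finally have "a\<^sup>2 * (h * l) ^ (card I - 4) \<le> a\<^sup>2 * (h ^ (2 * (card B - 1)) * l ^ (2 * (card I - card B)))"
    by (rule mult_left_mono) simp
  also have "\<dots> = (a * h ^ (card B - 1) * l ^ (card I - card B))\<^sup>2"
    by (simp add: power_mult_distrib power_mult[symmetric] mult.commute)
  also have "\<dots> \<le> (\<Prod>i\<in>I. f i)\<^sup>2"
    using main l assms(7) by (intro power_mono) auto
  finally show ?thesis .
qed

text \<open>Let \<open>x\<close> be the least error. If \<open>x > 23/10\<close>, all factors are
  large. Otherwise the threshold \<open>\<eta>\<close> of \<open>quartic_bound\<close> is
  incompatible with \<open>sel\<close>, so almost half of the errors exceed \<open>\<eta>\<close>,
  and each of them paired with an error of at least \<open>x\<close> contributes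
  \<open>4 * exp 1\<close> to the squared product.\<close>

lemma selection_failure_prod_lower:
  fixes e :: "'i \<Rightarrow> real"
  assumes fin: "finite I" and card: "4 \<le> card I"
    and e_nonneg: "\<And>K. K \<in> I \<Longrightarrow> 0 \<le> e K"
    and Ks: "Ks \<in> I" and large: "80.66 \<le> (e Ks)\<^sup>2"
    and sel: "\<And>Ko \<eta>. Ko \<in> I \<Longrightarrow> 2 * card {J \<in> I. \<eta> < e J} + 2 < card I \<Longrightarrow>
      e Ks \<le> (1 + sqrt 2) * \<eta> + sqrt 2 * e Ko"
  shows "(2 * exp (1/2)) ^ card I / 2 \<le> (\<Prod>J\<in>I. 1 + 3/4 * (e J)\<^sup>2)"
proof -
  let ?V = "card I" and ?f = "\<lambda>J. 1 + 3/4 * (e J)\<^sup>2"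
  have e1: "0 < exp (1::real)" by simp
  have "((2 * exp (1/2)) ^ ?V / 2)\<^sup>2 = (4 * exp 1) ^ ?V / (4::real)"
  proof -
    have "((2 * exp (1/2)) ^ ?V / 2)\<^sup>2 = ((2 * exp (1/2))\<^sup>2) ^ ?V / (4::real)"
      unfolding power_divide power_mult[symmetric] by (simp add: mult.commute[of 2])
    also have "(2 * exp (1/2))\<^sup>2 = 4 * exp (1::real)"
      by (simp add: power_mult_distrib flip: exp_of_nat_mult)
    finally show ?thesis .
  qed
  also have "\<dots> \<le> (\<Prod>J\<in>I. ?f J)\<^sup>2"
  proof -
    define x where "x = Min (e ` I)"
    obtain Ko where Ko: "Ko \<in> I" "x = e Ko"
      using Min_in[of "e ` I"] fin Ks unfolding x_def by fastforce
    have xmin: "x \<le> e J" if "J \<in> I" for J using that fin by (simp add: x_def)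
    have x0: "0 \<le> x" using Ko e_nonneg by simp
    show ?thesis
    proof (cases "x \<le> (23/10)")
      case True
      define \<eta> where "\<eta> = (93/25) - (293/500) * x"
      define B where "B = {J \<in> I. \<eta> < e J}"
      have s2: "sqrt 2 \<le> (70711/50000)" by (rule real_le_lsqrt) (auto simp: power2_eq_square)
      have eKs: "8.981 < e Ks"
      proof (rule power2_less_imp_less)
        show "8.981\<^sup>2 < (e Ks)\<^sup>2" using large by (simp add: power2_eq_square)
      qed (use e_nonneg Ks in auto)
      \<comment> \<open>The coefficient of \<open>x\<close> is just barely non-positive, so
        \<open>x = 0\<close> is the worst case, and there the value is still below
        \<open>8.981 < sqrt 80.66\<close>.\<close>
      have "(1 + sqrt 2) * \<eta> + sqrt 2 * x = (1 + sqrt 2) * (93/25) - ((293/500) - (207/500) * sqrt 2) * x"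
        by (simp add: \<eta>_def field_simps)
      also have "\<dots> \<le> (1 + sqrt 2) * (93/25)"
        using s2 x0 mult_nonneg_nonneg[of "(293/500) - (207/500) * sqrt 2" x] by linarith
      also have "\<dots> < e Ks" using s2 eKs by simp
      finally have "\<not> 2 * card B + 2 < ?V"
        using sel[OF Ko(1), of \<eta>] unfolding B_def Ko(2) by fastforce
      then have cB: "?V \<le> 2 * card B + 2" by simp
      have eta: "x \<le> \<eta>" "\<eta> \<le> (93/25)" "0 \<le> \<eta>" using True x0 by (auto simp: \<eta>_def)
      have hl: "4 * exp 1 \<le> (1 + 3/4 * \<eta>\<^sup>2) * (1 + 3/4 * x\<^sup>2)"
        unfolding \<eta>_def by (rule quartic_bound[OF x0 True])
      \<comment> \<open>Four of the \<open>?V\<close> factors \<open>4 * exp 1\<close> are set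
        aside; the squared factor of \<open>Ks\<close> pays for them.\<close>
      have "(4 * exp 1) ^ ?V / (4::real) = 64 * (exp 1)^4 * (4 * exp 1) ^ (?V - 4)"
      proof -
        have "(4 * exp (1::real)) ^ ?V = (4 * exp 1) ^ 4 * (4 * exp 1) ^ (?V - 4)"
          using card by (metis le_add_diff_inverse power_add)
        then show ?thesis by (simp add: power_mult_distrib)
      qed
      also have "\<dots> \<le> (1 + 3/4 * 80.66)\<^sup>2 * ((1 + 3/4 * \<eta>\<^sup>2) * (1 + 3/4 * x\<^sup>2)) ^ (?V - 4)"
      proof (rule mult_mono)
        show "(4 * exp 1) ^ (?V - 4) \<le> ((1 + 3/4 * \<eta>\<^sup>2) * (1 + 3/4 * x\<^sup>2)) ^ (?V - 4)"
          using hl by (rule power_mono) simp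
        have "exp (1::real) ^ 4 \<le> 2.7183 ^ 4" using exp1_bounds(2) by (intro power_mono) auto
        then show "64 * exp 1 ^ 4 \<le> (1 + 3 / 4 * 80.66 :: real)\<^sup>2"
          by (simp add: power4_eq_xxxx power2_eq_square)
      qed auto
      also have "\<dots> \<le> (\<Prod>J\<in>I. ?f J)\<^sup>2"
      proof (rule prod_power_split_lower[OF fin, where B = B and k = Ks])
        show "Ks \<in> B" using Ks eKs eta by (simp add: B_def)
        show "1 + 3/4 * x\<^sup>2 \<le> 1 + 3/4 * \<eta>\<^sup>2" using eta x0 by (simp add: power_mono)
        show "1 + 3/4 * x\<^sup>2 \<le> 1 + 3/4 * (e J)\<^sup>2" if "J \<in> I" for J
          using xmin[OF that] x0 by (simp add: power_mono)
        show "1 + 3/4 * \<eta>\<^sup>2 \<le> 1 + 3/4 * (e J)\<^sup>2" if "J \<in> B" for J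
          using that eta by (auto simp: B_def intro!: power_mono)
      qed (use large card cB in \<open>auto simp: B_def\<close>)
      finally show ?thesis .
    next
      case False
      \<comment> \<open>Every factor is at least \<open>1 + 3/4 * (23/10)\<^sup>2 > 4.9\<close>, and
        \<open>4.9\<^sup>2 > 4 * exp 1\<close>.\<close>
      have "(4 * exp 1) ^ ?V / (4::real) \<le> (4 * exp 1) ^ ?V" by simp
      also have "\<dots> \<le> (4.9\<^sup>2) ^ ?V"
        using exp1_bounds(2) by (intro power_mono) (auto simp: power2_eq_square)
      also have "\<dots> = (\<Prod>J\<in>I. 4.9)\<^sup>2" by (simp add: power_mult[symmetric] mult.commute)
      also have "\<dots> \<le> (\<Prod>J\<in>I. ?f J)\<^sup>2"
      proof (intro power_mono prod_mono conjI)
        fix J assume J: "J \<in> I"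
        have "(23/10)\<^sup>2 \<le> (e J)\<^sup>2" using False xmin[OF J] by (intro power_mono) auto
        then show "4.9 \<le> ?f J" by (simp add: power2_eq_square)
      qed (auto intro: prod_nonneg)
      finally show ?thesis .
    qed
  qed
  finally show ?thesis
    by (rule power2_le_imp_le) (auto intro!: prod_nonneg)
qed

subsection \<open>The inner product of \<open>L2\<close>\<close>

definition ip :: "'a measure \<Rightarrow> ('a \<Rightarrow> real) \<Rightarrow> ('a \<Rightarrow> real) \<Rightarrow> real" where
  "ip \<mu> f g = (\<integral>x. f x * g x \<partial>\<mu>)"

lemma L2_measurable: "f \<in> L2 \<mu> \<Longrightarrow> f \<in> borel_measurable \<mu>"
  by (simp add: L2_def)

lemma L2_integrable_mult:
  assumes "f \<in> L2 \<mu>" "g \<in> L2 \<mu>"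
  shows "integrable \<mu> (\<lambda>x. f x * g x)"
proof (rule Bochner_Integration.integrable_bound)
  show "integrable \<mu> (\<lambda>x. (f x)\<^sup>2 + (g x)\<^sup>2)" using assms by (auto simp: L2_def)
  show "(\<lambda>x. f x * g x) \<in> borel_measurable \<mu>" using assms by (auto simp: L2_def)
  have "\<bar>a * b\<bar> \<le> a\<^sup>2 + b\<^sup>2" for a b :: real
  proof -
    have "2 * (\<bar>a\<bar> * \<bar>b\<bar>) \<le> \<bar>a\<bar>\<^sup>2 + \<bar>b\<bar>\<^sup>2"
      using sum_squares_bound[of "\<bar>a\<bar>" "\<bar>b\<bar>"] by (simp add: mult.assoc)
    moreover have "0 \<le> \<bar>a\<bar> * \<bar>b\<bar>" by simp
    ultimately show ?thesis unfolding abs_mult power2_abs by linarith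
  qed
  then show "AE x in \<mu>. norm (f x * g x) \<le> norm ((f x)\<^sup>2 + (g x)\<^sup>2)"
    by simp
qed

lemma L2_zero: "(\<lambda>x. 0) \<in> L2 \<mu>"
  by (simp add: L2_def)

lemma L2_scale: "f \<in> L2 \<mu> \<Longrightarrow> (\<lambda>x. c * f x) \<in> L2 \<mu>"
  by (auto simp: L2_def power_mult_distrib)

lemma L2_add:
  assumes "f \<in> L2 \<mu>" "g \<in> L2 \<mu>"
  shows "(\<lambda>x. f x + g x) \<in> L2 \<mu>"
proof -
  have "(\<lambda>x. (f x + g x)\<^sup>2) = (\<lambda>x. (f x)\<^sup>2 + (g x)\<^sup>2 + 2 * (f x * g x))"
    by (auto simp: power2_eq_square algebra_simps)
  then show ?thesis
    using assms L2_integrable_mult[OF assms] by (auto simp: L2_def)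
qed

lemma L2_diff:
  assumes "f \<in> L2 \<mu>" "g \<in> L2 \<mu>"
  shows "(\<lambda>x. f x - g x) \<in> L2 \<mu>"
  using L2_add[OF assms(1) L2_scale[OF assms(2), of "-1"]] by simp

lemma L2_sum:
  assumes "\<And>i. i \<in> A \<Longrightarrow> f i \<in> L2 \<mu>"
  shows "(\<lambda>x. \<Sum>i\<in>A. f i x) \<in> L2 \<mu>"
  using assms by (induction A rule: infinite_finite_induct) (auto intro: L2_zero L2_add)

lemma L2_indicator:
  assumes "A \<in> sets \<mu>" "emeasure \<mu> A < \<infinity>"
  shows "indicator A \<in> L2 \<mu>"
proof -
  have "(\<lambda>x. (indicator A x :: real)\<^sup>2) = indicator A"
    by (auto simp: indicator_def)
  then show ?thesis using assms by (simp add: L2_def)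
qed

lemma ip_commute: "ip \<mu> f g = ip \<mu> g f"
  by (simp add: ip_def mult.commute)

lemma ip_self_nonneg: "0 \<le> ip \<mu> f f"
  by (simp add: ip_def)

lemma norm2_power2: "(norm2 \<mu> f)\<^sup>2 = ip \<mu> f f"
  by (simp add: norm2_def ip_def power2_eq_square)

lemma norm2_nonneg: "0 \<le> norm2 \<mu> f"
  by (simp add: norm2_def)

lemma ip_scale_right: "ip \<mu> f (\<lambda>x. c * g x) = c * ip \<mu> f g"
  by (simp add: ip_def mult.left_commute)

lemma ip_scale_left: "ip \<mu> (\<lambda>x. c * f x) g = c * ip \<mu> f g"
  by (simp add: ip_def mult.assoc)

lemma ip_add_right:
  "f \<in> L2 \<mu> \<Longrightarrow> g \<in> L2 \<mu> \<Longrightarrow> h \<in> L2 \<mu> \<Longrightarrow> ip \<mu> f (\<lambda>x. g x + h x) = ip \<mu> f g + ip \<mu> f h"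
  by (simp add: ip_def distrib_left L2_integrable_mult)

lemma ip_diff_right:
  "f \<in> L2 \<mu> \<Longrightarrow> g \<in> L2 \<mu> \<Longrightarrow> h \<in> L2 \<mu> \<Longrightarrow> ip \<mu> f (\<lambda>x. g x - h x) = ip \<mu> f g - ip \<mu> f h"
  by (simp add: ip_def right_diff_distrib L2_integrable_mult)

lemma ip_diff_left:
  "f \<in> L2 \<mu> \<Longrightarrow> g \<in> L2 \<mu> \<Longrightarrow> h \<in> L2 \<mu> \<Longrightarrow> ip \<mu> (\<lambda>x. g x - h x) f = ip \<mu> g f - ip \<mu> h f"
  by (simp add: ip_commute[of \<mu> _ f] ip_diff_right)

lemma ip_add_self:
  assumes "f \<in> L2 \<mu>" "g \<in> L2 \<mu>"
  shows "ip \<mu> (\<lambda>x. f x + g x) (\<lambda>x. f x + g x) = ip \<mu> f f + 2 * ip \<mu> f g + ip \<mu> g g"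
  using assms L2_add[OF assms]
  by (simp add: ip_add_right ip_commute[of \<mu> "\<lambda>x. f x + g x" f] ip_commute[of \<mu> "\<lambda>x. f x + g x" g] ip_commute[of \<mu> g f])

lemma ip_diff_self:
  assumes "f \<in> L2 \<mu>" "g \<in> L2 \<mu>"
  shows "ip \<mu> (\<lambda>x. f x - g x) (\<lambda>x. f x - g x) = ip \<mu> f f - 2 * ip \<mu> f g + ip \<mu> g g"
  using assms L2_diff[OF assms]
  by (simp add: ip_diff_right ip_commute[of \<mu> "\<lambda>x. f x - g x" f] ip_commute[of \<mu> "\<lambda>x. f x - g x" g] ip_commute[of \<mu> g f])

lemma ip_sum_right:
  assumes "f \<in> L2 \<mu>" "\<And>i. i \<in> A \<Longrightarrow> g i \<in> L2 \<mu>"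
  shows "ip \<mu> f (\<lambda>x. \<Sum>i\<in>A. c i * g i x) = (\<Sum>i\<in>A. c i * ip \<mu> f (g i))"
  using assms(2)
proof (induction A rule: infinite_finite_induct)
  case (insert i A)
  then have "(\<lambda>x. c i * g i x) \<in> L2 \<mu>" "(\<lambda>x. \<Sum>i\<in>A. c i * g i x) \<in> L2 \<mu>"
    by (intro L2_sum L2_scale; simp)+
  then show ?case using insert assms(1) by (simp add: ip_add_right ip_scale_right)
qed (auto simp: ip_def)

text \<open>The quadratic \<open>q\<close> in \<open>c\<close> is non-negative. Null functions need
  not be zero, so \<open>ip \<mu> g g = 0\<close> is a case of its own, in which \<open>q\<close> is
  affine and must be constant.\<close>

lemma ip_cauchy_schwarz:
  assumes "f \<in> L2 \<mu>" "g \<in> L2 \<mu>"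
  shows "(ip \<mu> f g)\<^sup>2 \<le> ip \<mu> f f * ip \<mu> g g"
proof -
  have q: "0 \<le> ip \<mu> f f - 2 * (c * ip \<mu> f g) + c\<^sup>2 * ip \<mu> g g" for c
    using ip_self_nonneg[of \<mu> "\<lambda>x. f x - c * g x"] assms
    by (simp add: ip_diff_self L2_scale ip_scale_left ip_scale_right power2_eq_square)
  show ?thesis
  proof (cases "ip \<mu> g g = 0")
    case True
    have "ip \<mu> f g = 0"
    proof (rule ccontr)
      assume "ip \<mu> f g \<noteq> 0"
      then show False using q[of "(ip \<mu> f f + 1) / (2 * ip \<mu> f g)"] True by (simp add: field_simps)
    qed
    then show ?thesis using True by simp
  next
    case False
    then have "0 < ip \<mu> g g" using ip_self_nonneg[of \<mu> g] by simp
    then show ?thesis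
      using q[of "ip \<mu> f g / ip \<mu> g g"] by (simp add: field_simps power2_eq_square)
  qed
qed

lemma abs_ip_le_norm2:
  assumes "f \<in> L2 \<mu>" "g \<in> L2 \<mu>"
  shows "\<bar>ip \<mu> f g\<bar> \<le> norm2 \<mu> f * norm2 \<mu> g"
proof (rule power2_le_imp_le)
  show "\<bar>ip \<mu> f g\<bar>\<^sup>2 \<le> (norm2 \<mu> f * norm2 \<mu> g)\<^sup>2"
    using ip_cauchy_schwarz[OF assms] by (simp add: power_mult_distrib norm2_power2)
qed (simp add: norm2_nonneg)

text \<open>Parallelogram identity for \<open>f - g\<close> and \<open>g - h\<close> with one square
  dropped; it serves as triangle inequality in the approximation arguments.\<close>

lemma ip_diff_self_triangle:
  assumes "f \<in> L2 \<mu>" "g \<in> L2 \<mu>" "h \<in> L2 \<mu>"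
  shows "ip \<mu> (\<lambda>x. f x - h x) (\<lambda>x. f x - h x) \<le>
    2 * ip \<mu> (\<lambda>x. f x - g x) (\<lambda>x. f x - g x) + 2 * ip \<mu> (\<lambda>x. g x - h x) (\<lambda>x. g x - h x)"
  using ip_self_nonneg[of \<mu> "\<lambda>x. (f x - g x) - (g x - h x)"]
    ip_diff_self[OF L2_diff[OF assms(1,2)] L2_diff[OF assms(2,3)]]
    ip_add_self[OF L2_diff[OF assms(1,2)] L2_diff[OF assms(2,3)]] by simp

subsection \<open>Orthonormal systems\<close>

definition orthonormal_or_zero :: "'a measure \<Rightarrow> (nat \<Rightarrow> 'a \<Rightarrow> real) \<Rightarrow> bool" where
  "orthonormal_or_zero \<mu> \<psi> \<longleftrightarrow> (\<forall>j. \<psi> j \<in> L2 \<mu>) \<and> (\<forall>j k. j \<noteq> k \<longrightarrow> ip \<mu> (\<psi> j) (\<psi> k) = 0) \<and>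
     (\<forall>k. ip \<mu> (\<psi> k) (\<psi> k) \<in> {0, 1})"

lemma orthonormal_or_zero_L2: "orthonormal_or_zero \<mu> \<psi> \<Longrightarrow> \<psi> j \<in> L2 \<mu>"
  by (simp add: orthonormal_or_zero_def)

lemma orthonormal_sum_L2: "orthonormal_or_zero \<mu> \<psi> \<Longrightarrow> (\<lambda>x. \<Sum>j<N. c j * \<psi> j x) \<in> L2 \<mu>"
  by (intro L2_sum L2_scale orthonormal_or_zero_L2)

lemma orthonormal_or_zero_cases:
  assumes "orthonormal_or_zero \<mu> \<psi>"
  obtains "ip \<mu> (\<psi> j) (\<psi> j) = 0" | "ip \<mu> (\<psi> j) (\<psi> j) = 1"
  using assms by (auto simp: orthonormal_or_zero_def)

lemma orthonormal_ip_sum_self: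
  assumes \<psi>: "orthonormal_or_zero \<mu> \<psi>"
  shows "ip \<mu> (\<lambda>x. \<Sum>j<N. c j * \<psi> j x) (\<lambda>x. \<Sum>j<N. c j * \<psi> j x) =
    (\<Sum>j<N. (c j)\<^sup>2 * ip \<mu> (\<psi> j) (\<psi> j))"
proof -
  let ?s = "\<lambda>x. \<Sum>j<N. c j * \<psi> j x"
  have s: "?s \<in> L2 \<mu>" by (rule orthonormal_sum_L2[OF \<psi>])
  have "ip \<mu> ?s (\<psi> k) = c k * ip \<mu> (\<psi> k) (\<psi> k)" if "k < N" for k
  proof -
    have "ip \<mu> (\<psi> k) ?s = (\<Sum>j<N. c j * ip \<mu> (\<psi> k) (\<psi> j))"
      by (intro ip_sum_right orthonormal_or_zero_L2[OF \<psi>])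
    also have "\<dots> = (\<Sum>j<N. if j = k then c k * ip \<mu> (\<psi> k) (\<psi> k) else 0)"
      using \<psi> by (intro sum.cong) (auto simp: orthonormal_or_zero_def)
    finally show ?thesis using that by (simp add: ip_commute[of \<mu> ?s "\<psi> k"])
  qed
  then have "(\<Sum>j<N. c j * ip \<mu> ?s (\<psi> j)) = (\<Sum>j<N. (c j)\<^sup>2 * ip \<mu> (\<psi> j) (\<psi> j))"
    by (intro sum.cong) (auto simp: power2_eq_square)
  then show ?thesis
    using ip_sum_right[OF s, of "{..<N}" \<psi> c] orthonormal_or_zero_L2[OF \<psi>] by simp
qed

lemma orthonormal_ip_sum_self_le:
  assumes \<psi>: "orthonormal_or_zero \<mu> \<psi>"
  shows "ip \<mu> (\<lambda>x. \<Sum>j<N. c j * \<psi> j x) (\<lambda>x. \<Sum>j<N. c j * \<psi> j x) \<le> (\<Sum>j<N. (c j)\<^sup>2)"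
  unfolding orthonormal_ip_sum_self[OF \<psi>]
proof (rule sum_mono)
  fix j show "(c j)\<^sup>2 * ip \<mu> (\<psi> j) (\<psi> j) \<le> (c j)\<^sup>2"
    by (rule orthonormal_or_zero_cases[OF \<psi>, of j]) auto
qed

text \<open>Both parts read off the expansion of the squared distance from \<open>w\<close> to a
  combination: each coefficient gains at most \<open>(ip \<mu> w (\<psi> j))\<^sup>2\<close>,
  attained at \<open>ip \<mu> w (\<psi> j)\<close>. For a null member this inner product
  vanishes.\<close>

lemma
  assumes \<psi>: "orthonormal_or_zero \<mu> \<psi>" and w: "w \<in> L2 \<mu>"
  shows orthonormal_best_approx: "ip \<mu> w w - (\<Sum>j<N. (ip \<mu> w (\<psi> j))\<^sup>2) \<le>
    ip \<mu> (\<lambda>x. w x - (\<Sum>j<N. c j * \<psi> j x)) (\<lambda>x. w x - (\<Sum>j<N. c j * \<psi> j x))" (is ?le)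
    and orthonormal_bessel: "(\<Sum>j<N. (ip \<mu> w (\<psi> j))\<^sup>2) \<le> ip \<mu> w w" (is ?bessel)
proof -
  have exp: "ip \<mu> (\<lambda>x. w x - (\<Sum>j<N. c j * \<psi> j x)) (\<lambda>x. w x - (\<Sum>j<N. c j * \<psi> j x)) =
      ip \<mu> w w - (\<Sum>j<N. 2 * (c j * ip \<mu> w (\<psi> j)) - (c j)\<^sup>2 * ip \<mu> (\<psi> j) (\<psi> j))" for c
  proof -
    let ?s = "\<lambda>x. \<Sum>j<N. c j * \<psi> j x"
    have s: "?s \<in> L2 \<mu>" by (rule orthonormal_sum_L2[OF \<psi>])
    have "ip \<mu> w ?s = (\<Sum>j<N. c j * ip \<mu> w (\<psi> j))"
      using \<psi> w by (intro ip_sum_right) (auto intro: orthonormal_or_zero_L2)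
    then show ?thesis
      by (simp add: ip_diff_self[OF w s] orthonormal_ip_sum_self[OF \<psi>] sum_subtractf sum_distrib_left)
  qed
  have bound: "2 * (a * ip \<mu> w (\<psi> j)) - a\<^sup>2 * ip \<mu> (\<psi> j) (\<psi> j) \<le> (ip \<mu> w (\<psi> j))\<^sup>2" for a j
  proof (rule orthonormal_or_zero_cases[OF \<psi>, of j])
    assume "ip \<mu> (\<psi> j) (\<psi> j) = 0"
    then show ?thesis
      using ip_cauchy_schwarz[OF w orthonormal_or_zero_L2[OF \<psi>], of j] by simp
  next
    assume "ip \<mu> (\<psi> j) (\<psi> j) = 1"
    then show ?thesis
      using zero_le_power2[of "a - ip \<mu> w (\<psi> j)"] by (simp add: power2_eq_square algebra_simps)
  qed
  show ?le unfolding exp by (intro diff_left_mono sum_mono bound)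
  have "(\<Sum>j<N. (ip \<mu> w (\<psi> j))\<^sup>2) \<le>
      (\<Sum>j<N. 2 * (ip \<mu> w (\<psi> j) * ip \<mu> w (\<psi> j)) - (ip \<mu> w (\<psi> j))\<^sup>2 * ip \<mu> (\<psi> j) (\<psi> j))"
  proof (rule sum_mono)
    fix j show "(ip \<mu> w (\<psi> j))\<^sup>2 \<le>
        2 * (ip \<mu> w (\<psi> j) * ip \<mu> w (\<psi> j)) - (ip \<mu> w (\<psi> j))\<^sup>2 * ip \<mu> (\<psi> j) (\<psi> j)"
      by (rule orthonormal_or_zero_cases[OF \<psi>, of j]) (auto simp: power2_eq_square)
  qed
  then show ?bessel
    using exp[of "\<lambda>j. ip \<mu> w (\<psi> j)"]
      ip_self_nonneg[of \<mu> "\<lambda>x. w x - (\<Sum>j<N. ip \<mu> w (\<psi> j) * \<psi> j x)"] by linarith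
qed

lemma linear_space_add:
  "linear_space_of_functions S \<Longrightarrow> f \<in> S \<Longrightarrow> g \<in> S \<Longrightarrow> (\<lambda>x. f x + g x) \<in> S"
  unfolding linear_space_of_functions_def by blast

lemma linear_space_scale:
  "linear_space_of_functions S \<Longrightarrow> f \<in> S \<Longrightarrow> (\<lambda>x. c * f x) \<in> S"
  unfolding linear_space_of_functions_def by blast

text \<open>The shape of a Gram--Schmidt residual; differences are the case of one summand and sums
  the case \<open>f = 0\<close>.\<close>

lemma linear_space_diff_sum:
  assumes S: "linear_space_of_functions S" and "f \<in> S" "finite A" "\<And>j. j \<in> A \<Longrightarrow> g j \<in> S"
  shows "(\<lambda>x. f x - (\<Sum>j\<in>A. c j * g j x)) \<in> S"
  using assms(3,4)
proof (induction A rule: finite_induct)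
  case empty
  then show ?case using assms by simp
next
  case (insert i A)
  have "(\<lambda>x. - c i * g i x) \<in> S" using insert by (intro linear_space_scale[OF S]) auto
  moreover have "(\<lambda>x. f x - (\<Sum>j\<in>A. c j * g j x)) \<in> S" using insert by auto
  ultimately have "(\<lambda>x. (f x - (\<Sum>j\<in>A. c j * g j x)) + - c i * g i x) \<in> S"
    by (rule linear_space_add[OF S, rotated])
  moreover have "(\<lambda>x. (f x - (\<Sum>j\<in>A. c j * g j x)) + - c i * g i x) =
      (\<lambda>x. f x - (\<Sum>j\<in>insert i A. c j * g j x))"
    using insert by (auto simp: algebra_simps)
  ultimately show ?case by simp
qed

lemma linear_space_diff:
  assumes "linear_space_of_functions S" "f \<in> S" "g \<in> S"
  shows "(\<lambda>x. f x - g x) \<in> S"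
  using linear_space_diff_sum[of S f "{()}" "\<lambda>_. g" "\<lambda>_. 1"] assms by simp

lemma linear_space_sum:
  assumes "linear_space_of_functions S" "finite A" "\<And>j. j \<in> A \<Longrightarrow> g j \<in> S"
  shows "(\<lambda>x. \<Sum>j\<in>A. c j * g j x) \<in> S"
proof -
  have "(\<lambda>x. 0) \<in> S" using assms(1) by (simp add: linear_space_of_functions_def)
  from linear_space_diff_sum[OF assms(1) this assms(2,3), where c = "\<lambda>j. - c j"]
  show ?thesis by (simp add: sum_negf)
qed

lemma linear_space_L2: "linear_space_of_functions (L2 \<mu>)"
  by (auto simp: linear_space_of_functions_def L2_zero L2_add L2_scale)

section \<open>Gram--Schmidt sequences\<close>

definition normalized :: "'a measure \<Rightarrow> ('a \<Rightarrow> real) \<Rightarrow> 'a \<Rightarrow> real" where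
  "normalized \<mu> r x = 1 / norm2 \<mu> r * r x"

text \<open>Division by zero turns a null residual into the zero function, so that the sequence may
  contain zeros besides unit vectors.\<close>

fun gram_schmidt :: "'a measure \<Rightarrow> (nat \<Rightarrow> 'a \<Rightarrow> real) \<Rightarrow> nat \<Rightarrow> 'a \<Rightarrow> real" where
  "gram_schmidt \<mu> d k =
     normalized \<mu> (\<lambda>x. d k x - (\<Sum>j<k. ip \<mu> (d k) (gram_schmidt \<mu> d j) * gram_schmidt \<mu> d j x))"

declare gram_schmidt.simps [simp del]

lemma gram_schmidt_in:
  assumes S: "linear_space_of_functions S" and d: "\<And>k. d k \<in> S"
  shows "gram_schmidt \<mu> d k \<in> S"
proof (induction k rule: less_induct)
  case (less k)
  let ?r = "\<lambda>x. d k x - (\<Sum>j<k. ip \<mu> (d k) (gram_schmidt \<mu> d j) * gram_schmidt \<mu> d j x)"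
  have "?r \<in> S"
    by (rule linear_space_diff_sum[OF S d]) (auto intro: less)
  then have "(\<lambda>x. 1 / norm2 \<mu> ?r * ?r x) \<in> S" by (rule linear_space_scale[OF S])
  moreover have "gram_schmidt \<mu> d k = (\<lambda>x. 1 / norm2 \<mu> ?r * ?r x)"
    by (rule ext) (simp add: gram_schmidt.simps[of \<mu> d k] normalized_def)
  ultimately show ?case by simp
qed

lemma gram_schmidt_orthonormal:
  assumes d: "\<And>k. d k \<in> L2 \<mu>"
  shows "orthonormal_or_zero \<mu> (gram_schmidt \<mu> d)"
proof -
  let ?g = "gram_schmidt \<mu> d"
  let ?r = "\<lambda>k x. d k x - (\<Sum>j<k. ip \<mu> (d k) (?g j) * ?g j x)"
  have g: "?g k \<in> L2 \<mu>" for k by (rule gram_schmidt_in[OF linear_space_L2 d])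
  have g_r: "?g k = (\<lambda>x. 1 / norm2 \<mu> (?r k) * ?r k x)" for k
    by (rule ext) (simp add: gram_schmidt.simps[of \<mu> d k] normalized_def)
  have self: "ip \<mu> (?g k) (?g k) \<in> {0, 1}" for k
  proof -
    have "ip \<mu> (?g k) (?g k) = ip \<mu> (?r k) (?r k) / (norm2 \<mu> (?r k))\<^sup>2"
      by (subst (1 2) g_r[of k], subst ip_scale_right, subst ip_scale_left) (simp add: power2_eq_square)
    then show ?thesis unfolding norm2_power2 by auto
  qed
  have orth: "\<forall>j<k. ip \<mu> (?g j) (?g k) = 0" for k
  proof (induction k rule: less_induct)
    case (less k)
    have "ip \<mu> (?g i) (?g k) = 0" if i: "i < k" for i
    proof -
      have "ip \<mu> (?g i) (\<lambda>x. \<Sum>j<k. ip \<mu> (d k) (?g j) * ?g j x) =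
          (\<Sum>j<k. ip \<mu> (d k) (?g j) * ip \<mu> (?g i) (?g j))"
        by (intro ip_sum_right g)
      also have "\<dots> = (\<Sum>j<k. if j = i then ip \<mu> (d k) (?g i) * ip \<mu> (?g i) (?g i) else 0)"
      proof (intro sum.cong refl)
        fix j assume "j \<in> {..<k}"
        then have "ip \<mu> (?g i) (?g j) = 0" if "j \<noteq> i"
          using that i less[of i] less[of j] ip_commute[of \<mu> "?g i" "?g j"]
          by (metis lessThan_iff linorder_neqE_nat)
        then show "ip \<mu> (d k) (?g j) * ip \<mu> (?g i) (?g j) =
            (if j = i then ip \<mu> (d k) (?g i) * ip \<mu> (?g i) (?g i) else 0)" by auto
      qed
      also have "\<dots> = ip \<mu> (d k) (?g i) * ip \<mu> (?g i) (?g i)" using i by simp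
      \<comment> \<open>Either \<open>?g i\<close> has norm 1, or it is null and both sides vanish
        by Cauchy--Schwarz.\<close>
      also have "\<dots> = ip \<mu> (d k) (?g i)"
        using self[of i] ip_cauchy_schwarz[OF d[of k] g[of i]] by auto
      finally have "ip \<mu> (?g i) (?r k) = 0"
        using g d by (subst ip_diff_right) (auto simp: L2_sum L2_scale ip_commute[of \<mu> "?g i" "d k"])
      then have "ip \<mu> (?g i) (\<lambda>x. 1 / norm2 \<mu> (?r k) * ?r k x) = 0"
        by (subst ip_scale_right) simp
      then show ?thesis by (subst g_r[of k])
    qed
    then show ?case by blast
  qed
  have "ip \<mu> (?g j) (?g k) = 0" if "j \<noteq> k" for j k
    using that orth[of j] orth[of k] ip_commute[of \<mu> "?g j" "?g k"] by (metis linorder_neqE_nat)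
  then show ?thesis using g self by (simp add: orthonormal_or_zero_def)
qed

text \<open>With the norm of the residual as last coefficient, the error is
  \<open>1 - norm2 \<mu> r / norm2 \<mu> r\<close> times the residual \<open>r\<close>: zero if the
  norm is nonzero, and a null function otherwise.\<close>

lemma gram_schmidt_spans:
  obtains c where "ip \<mu> (\<lambda>x. d k x - (\<Sum>j<Suc k. c j * gram_schmidt \<mu> d j x))
    (\<lambda>x. d k x - (\<Sum>j<Suc k. c j * gram_schmidt \<mu> d j x)) = 0"
proof
  let ?g = "gram_schmidt \<mu> d"
  let ?r = "\<lambda>x. d k x - (\<Sum>j<k. ip \<mu> (d k) (?g j) * ?g j x)"
  let ?c = "\<lambda>j. if j = k then norm2 \<mu> ?r else ip \<mu> (d k) (?g j)"
  have eq: "(\<lambda>x. d k x - (\<Sum>j<Suc k. ?c j * ?g j x)) = (\<lambda>x. (1 - norm2 \<mu> ?r / norm2 \<mu> ?r) * ?r x)"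
  proof
    fix x
    have "?g k x = 1 / norm2 \<mu> ?r * ?r x"
      by (simp add: gram_schmidt.simps[of \<mu> d k] normalized_def)
    moreover have "(\<Sum>j<k. ?c j * ?g j x) = (\<Sum>j<k. ip \<mu> (d k) (?g j) * ?g j x)"
      by (intro sum.cong) auto
    ultimately show "d k x - (\<Sum>j<Suc k. ?c j * ?g j x) = (1 - norm2 \<mu> ?r / norm2 \<mu> ?r) * ?r x"
      by (simp add: left_diff_distrib)
  qed
  show "ip \<mu> (\<lambda>x. d k x - (\<Sum>j<Suc k. ?c j * ?g j x)) (\<lambda>x. d k x - (\<Sum>j<Suc k. ?c j * ?g j x)) = 0"
    unfolding eq ip_scale_left ip_scale_right norm2_power2[symmetric] by simp
qed

text \<open>Bessel bounds the partial sums from above. From below, some \<open>d k\<close> is close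
  to \<open>w\<close> and lies in the span of the first \<open>Suc k\<close> members up to a null
  function, so best approximation applies; completeness does not enter.\<close>

lemma gram_schmidt_parseval:
  assumes d: "\<And>k. d k \<in> L2 \<mu>" and w: "w \<in> L2 \<mu>"
    and dense: "\<And>\<epsilon>. \<epsilon> > 0 \<Longrightarrow> \<exists>k. ip \<mu> (\<lambda>x. w x - d k x) (\<lambda>x. w x - d k x) < \<epsilon>"
  shows "(\<lambda>k. (ip \<mu> w (gram_schmidt \<mu> d k))\<^sup>2) sums ip \<mu> w w"
proof -
  let ?g = "gram_schmidt \<mu> d"
  let ?a = "\<lambda>N. \<Sum>j<N. (ip \<mu> w (?g j))\<^sup>2"
  note g = gram_schmidt_orthonormal[of d, OF d]
  have "?a \<longlonglongrightarrow> ip \<mu> w w"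
  proof (rule LIMSEQ_I)
    fix \<epsilon> :: real assume "0 < \<epsilon>"
    then obtain k where k: "ip \<mu> (\<lambda>x. w x - d k x) (\<lambda>x. w x - d k x) < \<epsilon> / 2"
      using dense[of "\<epsilon> / 2"] by auto
    obtain c where c: "ip \<mu> (\<lambda>x. d k x - (\<Sum>j<Suc k. c j * ?g j x))
      (\<lambda>x. d k x - (\<Sum>j<Suc k. c j * ?g j x)) = 0"
      using gram_schmidt_spans by blast
    have s: "(\<lambda>x. \<Sum>j<Suc k. c j * ?g j x) \<in> L2 \<mu>"
      using g by (intro L2_sum L2_scale orthonormal_or_zero_L2)
    have "ip \<mu> w w - ?a (Suc k) \<le>
        ip \<mu> (\<lambda>x. w x - (\<Sum>j<Suc k. c j * ?g j x)) (\<lambda>x. w x - (\<Sum>j<Suc k. c j * ?g j x))"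
      by (rule orthonormal_best_approx[OF g w])
    also have "\<dots> < \<epsilon>"
      using ip_diff_self_triangle[OF w d[of k] s] c k by linarith
    finally have lt: "ip \<mu> w w - ?a (Suc k) < \<epsilon>" .
    have "norm (?a n - ip \<mu> w w) < \<epsilon>" if "Suc k \<le> n" for n
    proof -
      have "?a (Suc k) \<le> ?a n" using that by (intro sum_mono2) auto
      then show ?thesis using lt orthonormal_bessel[OF g w, of n] by simp
    qed
    then show "\<exists>no. \<forall>n\<ge>no. norm (?a n - ip \<mu> w w) < \<epsilon>" by blast
  qed
  then show ?thesis by (simp add: sums_def)
qed

subsection \<open>Separability of \<open>L2\<close>\<close>

definition countable_open_basis :: "'a::second_countable_topology set set" where
  "countable_open_basis = (SOME B. countable B \<and> topological_basis B)"

lemma countable_open_basis: "countable countable_open_basis" "topological_basis countable_open_basis"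
  using someI_ex[OF ex_countable_basis] unfolding countable_open_basis_def by auto

lemma countable_open_basis_nonempty: "countable_open_basis \<noteq> {}"
proof
  assume "countable_open_basis = ({} :: 'a set set)"
  then have "\<exists>B'\<subseteq>{}. \<Union> B' = (UNIV :: 'a set)"
    using countable_open_basis(2) unfolding topological_basis_def by (metis open_UNIV)
  then show False by auto
qed

text \<open>Finite intersections make the family stable under intersection, as Dynkin's theorem
  requires; lists of indices keep it countable, and the empty list gives the whole space.\<close>

definition basic_set :: "nat list \<Rightarrow> 'a::second_countable_topology set" where
  "basic_set is = (\<Inter>i\<in>set is. from_nat_into countable_open_basis i)"

text \<open>The ball makes the indicator square integrable.\<close>

definition basic_fun :: "nat list \<times> nat \<Rightarrow> 'a::euclidean_space \<Rightarrow> real" where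
  "basic_fun p = indicator (basic_set (fst p) \<inter> ball 0 (real (snd p)))"

text \<open>The parameters form a countable type, so \<open>from_nat\<close> can enumerate the
  combinations.\<close>

definition rat_comb :: "(rat \<times> nat list \<times> nat) list \<Rightarrow> 'a::euclidean_space \<Rightarrow> real" where
  "rat_comb l x = (\<Sum>(q, p)\<leftarrow>l. of_rat q * basic_fun p x)"

lemma basic_set_borel: "(basic_set is :: 'a::second_countable_topology set) \<in> sets borel"
proof -
  have "open (from_nat_into countable_open_basis i :: 'a set)" for i
    using topological_basis_open[OF countable_open_basis(2)]
      from_nat_into[OF countable_open_basis_nonempty] by blast
  then have "open (basic_set is :: 'a set)"
    unfolding basic_set_def by (intro open_INT) auto
  then show ?thesis by simp
qed

lemma sets_borel_eq_basic_sets: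
  "sets (borel :: 'a::second_countable_topology measure) = sigma_sets UNIV (range basic_set)"
proof
  have "borel = sigma UNIV (countable_open_basis :: 'a set set)"
    by (rule borel_eq_countable_basis[OF countable_open_basis])
  then have "sets (borel :: 'a measure) = sigma_sets UNIV countable_open_basis"
    by (subst \<open>borel = sigma UNIV countable_open_basis\<close>) (rule sets_measure_of, simp)
  also have "\<dots> \<subseteq> sigma_sets UNIV (range basic_set)"
  proof (rule sigma_sets_mono')
    have "from_nat_into countable_open_basis i = basic_set [i]" for i
      by (simp add: basic_set_def)
    then have "range (from_nat_into countable_open_basis) \<subseteq> (range basic_set :: 'a set set)"
      by auto
    then show "countable_open_basis \<subseteq> (range basic_set :: 'a set set)"
      by (simp add: countable_open_basis(1) countable_open_basis_nonempty)
  qed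
  finally show "sets (borel :: 'a measure) \<subseteq> sigma_sets UNIV (range basic_set)" .
  show "sigma_sets UNIV (range basic_set) \<subseteq> sets (borel :: 'a measure)"
    using sets.sigma_sets_subset[of "range basic_set" "borel :: 'a measure"] basic_set_borel
    by auto
qed

lemma Int_stable_basic_sets: "Int_stable (range basic_set :: 'a::second_countable_topology set set)"
proof (rule Int_stableI)
  fix a b :: "'a set" assume "a \<in> range basic_set" "b \<in> range basic_set"
  then obtain u v where "a = basic_set u" "b = basic_set v" by auto
  then have "a \<inter> b = basic_set (u @ v)" by (auto simp: basic_set_def)
  then show "a \<inter> b \<in> range basic_set" by auto
qed

lemma indicator_Int_ball_L2:
  assumes "A \<in> sets borel"
  shows "indicator (A \<inter> ball 0 r :: 'a::euclidean_space set) \<in> L2 lborel"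
proof (rule L2_indicator)
  have "emeasure lborel (A \<inter> ball 0 r) \<le> emeasure lborel (ball (0::'a) r)"
    using assms by (intro emeasure_mono) auto
  also have "\<dots> < \<infinity>" using emeasure_bounded_finite[of "ball (0::'a) r"] by simp
  finally show "emeasure lborel (A \<inter> ball 0 r) < \<infinity>" .
qed (use assms in auto)

lemma basic_fun_L2: "basic_fun p \<in> L2 lborel"
  unfolding basic_fun_def by (rule indicator_Int_ball_L2[OF basic_set_borel])

lemma rat_comb_L2: "(rat_comb l :: 'a::euclidean_space \<Rightarrow> real) \<in> L2 lborel"
proof (induction l)
  case Nil
  then show ?case using L2_zero by (simp add: rat_comb_def[abs_def])
next
  case (Cons a l)
  obtain q p where a: "a = (q, p)" by (cases a)
  have "rat_comb (a # l) = (\<lambda>x::'a. of_rat q * basic_fun p x + rat_comb l x)"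
    by (rule ext) (simp add: rat_comb_def a)
  then show ?case using Cons by (simp add: L2_add L2_scale basic_fun_L2)
qed

text \<open>The closure of the countable family \<open>rat_comb\<close> in \<open>L2 lborel\<close>.
  The lemmas below enlarge what is known to lie in it, up to the whole space.\<close>

definition rat_approximable :: "('a::euclidean_space \<Rightarrow> real) \<Rightarrow> bool" where
  "rat_approximable f \<longleftrightarrow> f \<in> L2 lborel \<and>
     (\<forall>\<epsilon>>0. \<exists>l. ip lborel (\<lambda>x. f x - rat_comb l x) (\<lambda>x. f x - rat_comb l x) < \<epsilon>)"

lemma rat_approximable_L2: "rat_approximable f \<Longrightarrow> f \<in> L2 lborel"
  by (simp add: rat_approximable_def)

lemma rat_approximable_limit:
  assumes f: "f \<in> L2 lborel"
    and "\<And>\<epsilon>. \<epsilon> > 0 \<Longrightarrow> \<exists>g. rat_approximable g \<and> ip lborel (\<lambda>x. f x - g x) (\<lambda>x. f x - g x) < \<epsilon>"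
  shows "rat_approximable f"
  unfolding rat_approximable_def
proof (intro conjI allI impI f)
  fix \<epsilon> :: real assume "0 < \<epsilon>"
  then obtain g where g: "rat_approximable g" "ip lborel (\<lambda>x. f x - g x) (\<lambda>x. f x - g x) < \<epsilon> / 4"
    using assms(2)[of "\<epsilon> / 4"] by auto
  then obtain l where l: "ip lborel (\<lambda>x. g x - rat_comb l x) (\<lambda>x. g x - rat_comb l x) < \<epsilon> / 4"
    using \<open>0 < \<epsilon>\<close> unfolding rat_approximable_def by (meson divide_pos_pos zero_less_numeral)
  have "g \<in> L2 lborel" using g by (simp add: rat_approximable_def)
  then have "ip lborel (\<lambda>x. f x - rat_comb l x) (\<lambda>x. f x - rat_comb l x) < \<epsilon>"
    using ip_diff_self_triangle[OF f _ rat_comb_L2, of g l] g l by simp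
  then show "\<exists>l. ip lborel (\<lambda>x. f x - rat_comb l x) (\<lambda>x. f x - rat_comb l x) < \<epsilon>" by blast
qed

lemma rat_approximable_add:
  assumes "rat_approximable f" "rat_approximable g"
  shows "rat_approximable (\<lambda>x. f x + g x)"
  unfolding rat_approximable_def
proof (intro conjI allI impI)
  have fg: "f \<in> L2 lborel" "g \<in> L2 lborel" using assms by (auto simp: rat_approximable_def)
  then show "(\<lambda>x. f x + g x) \<in> L2 lborel" by (rule L2_add)
  fix \<epsilon> :: real assume "0 < \<epsilon>"
  then obtain l m where
    l: "ip lborel (\<lambda>x. f x - rat_comb l x) (\<lambda>x. f x - rat_comb l x) < \<epsilon> / 4" and
    m: "ip lborel (\<lambda>x. g x - rat_comb m x) (\<lambda>x. g x - rat_comb m x) < \<epsilon> / 4"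
    using assms unfolding rat_approximable_def by (meson divide_pos_pos zero_less_numeral)
  have "(\<lambda>x. f x + g x - rat_comb (l @ m) x) = (\<lambda>x. (f x - rat_comb l x) - (rat_comb m x - g x))"
    by (auto simp: rat_comb_def)
  moreover have "ip lborel (\<lambda>x. rat_comb m x - g x) (\<lambda>x. rat_comb m x - g x) =
      ip lborel (\<lambda>x. g x - rat_comb m x) (\<lambda>x. g x - rat_comb m x)"
    by (simp add: ip_def algebra_simps)
  ultimately have "ip lborel (\<lambda>x. f x + g x - rat_comb (l @ m) x) (\<lambda>x. f x + g x - rat_comb (l @ m) x) < \<epsilon>"
    using ip_diff_self_triangle[of "\<lambda>x. f x - rat_comb l x" lborel "\<lambda>x. 0" "\<lambda>x. rat_comb m x - g x"]
      l m fg by (simp add: L2_diff rat_comb_L2 L2_zero)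
  then show "\<exists>l. ip lborel (\<lambda>x. f x + g x - rat_comb l x) (\<lambda>x. f x + g x - rat_comb l x) < \<epsilon>" by blast
qed

lemma rat_approximable_rat_scale:
  assumes "rat_approximable f"
  shows "rat_approximable (\<lambda>x. of_rat q * f x)"
  unfolding rat_approximable_def
proof (intro conjI allI impI)
  show "(\<lambda>x. of_rat q * f x) \<in> L2 lborel" using assms by (simp add: rat_approximable_def L2_scale)
  fix \<epsilon> :: real assume \<epsilon>: "0 < \<epsilon>"
  have pos: "0 < (of_rat q)\<^sup>2 + (1::real)" by (simp add: add_nonneg_pos)
  then obtain l where
    l: "ip lborel (\<lambda>x. f x - rat_comb l x) (\<lambda>x. f x - rat_comb l x) < \<epsilon> / ((of_rat q)\<^sup>2 + 1)"
    using assms \<epsilon> unfolding rat_approximable_def by (meson divide_pos_pos)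
  have "rat_comb (map (\<lambda>(r, p). (q * r, p)) l) x = of_rat q * rat_comb l x" for x :: 'a
    by (induction l) (auto simp: rat_comb_def algebra_simps of_rat_mult)
  then have "(\<lambda>x. of_rat q * f x - rat_comb (map (\<lambda>(r, p). (q * r, p)) l) x) =
      (\<lambda>x. of_rat q * (f x - rat_comb l x))" by (auto simp: algebra_simps)
  moreover have "ip lborel (\<lambda>x. of_rat q * (f x - rat_comb l x)) (\<lambda>x. of_rat q * (f x - rat_comb l x)) < \<epsilon>"
  proof -
    let ?i = "ip lborel (\<lambda>x. f x - rat_comb l x) (\<lambda>x. f x - rat_comb l x)"
    have "(of_rat q)\<^sup>2 * ?i \<le> ((of_rat q)\<^sup>2 + 1) * ?i"
      using ip_self_nonneg[of lborel "\<lambda>x. f x - rat_comb l x"] by (intro mult_right_mono) auto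
    also have "\<dots> < \<epsilon>" using l pos by (simp add: pos_less_divide_eq mult.commute)
    finally show ?thesis by (simp only: ip_scale_left ip_scale_right power2_eq_square mult.assoc)
  qed
  ultimately show "\<exists>l. ip lborel (\<lambda>x. of_rat q * f x - rat_comb l x) (\<lambda>x. of_rat q * f x - rat_comb l x) < \<epsilon>"
    by metis
qed

lemma rat_approximable_scale:
  assumes "rat_approximable f"
  shows "rat_approximable (\<lambda>x. c * f x)"
proof (rule rat_approximable_limit)
  show "(\<lambda>x. c * f x) \<in> L2 lborel" using assms by (simp add: rat_approximable_def L2_scale)
  fix \<epsilon> :: real assume \<epsilon>: "0 < \<epsilon>"
  define K where "K = ip lborel f f + 1"
  have K: "0 < K" "ip lborel f f < K" using ip_self_nonneg[of lborel f] by (auto simp: K_def)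
  define \<eta> where "\<eta> = sqrt (\<epsilon> / K)"
  have \<eta>: "0 < \<eta>" "\<eta>\<^sup>2 * K = \<epsilon>" using \<epsilon> K by (auto simp: \<eta>_def)
  obtain q where q: "c < of_rat q" "of_rat q < c + \<eta>" using of_rat_dense[of c "c + \<eta>"] \<eta> by auto
  have "(\<lambda>x. c * f x - of_rat q * f x) = (\<lambda>x. (c - of_rat q) * f x)"
    by (auto simp: algebra_simps)
  moreover have "(c - of_rat q)\<^sup>2 * ip lborel f f < \<epsilon>"
  proof -
    have "(c - of_rat q)\<^sup>2 \<le> \<eta>\<^sup>2" using q by (intro power2_le_iff_abs_le[THEN iffD2]) auto
    then have "(c - of_rat q)\<^sup>2 * ip lborel f f \<le> \<eta>\<^sup>2 * ip lborel f f"
      by (intro mult_right_mono ip_self_nonneg)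
    also have "\<dots> < \<eta>\<^sup>2 * K" using K \<eta> by (intro mult_strict_left_mono) auto
    finally show ?thesis using \<eta> by simp
  qed
  ultimately have "ip lborel (\<lambda>x. c * f x - of_rat q * f x) (\<lambda>x. c * f x - of_rat q * f x) < \<epsilon>"
    by (simp only: ip_scale_left ip_scale_right power2_eq_square mult.assoc)
  then show "\<exists>g. rat_approximable g \<and> ip lborel (\<lambda>x. c * f x - g x) (\<lambda>x. c * f x - g x) < \<epsilon>"
    using rat_approximable_rat_scale[OF assms, of q] by blast
qed

lemma rat_approximable_zero: "rat_approximable (\<lambda>x::'a::euclidean_space. 0)"
proof -
  have "rat_comb [] = (\<lambda>x::'a. 0)" by (rule ext) (simp add: rat_comb_def)
  then have "ip lborel (\<lambda>x::'a. 0 - rat_comb [] x) (\<lambda>x. 0 - rat_comb [] x) = 0" by (simp add: ip_def)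
  then show ?thesis unfolding rat_approximable_def using L2_zero by metis
qed

lemma rat_approximable_sum:
  "(\<And>i. i \<in> A \<Longrightarrow> rat_approximable (f i)) \<Longrightarrow> rat_approximable (\<lambda>x. \<Sum>i\<in>A. f i x)"
  by (induction A rule: infinite_finite_induct)
    (auto intro: rat_approximable_zero rat_approximable_add)

lemma rat_approximable_basic_fun: "rat_approximable (basic_fun p :: 'a::euclidean_space \<Rightarrow> real)"
proof -
  have "rat_comb [(1, p)] = (basic_fun p :: 'a \<Rightarrow> real)" by (rule ext) (simp add: rat_comb_def)
  then have "ip lborel (\<lambda>x::'a. basic_fun p x - rat_comb [(1, p)] x) (\<lambda>x. basic_fun p x - rat_comb [(1, p)] x) = 0"
    by (simp add: ip_def)
  then show ?thesis unfolding rat_approximable_def using basic_fun_L2 by metis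
qed

text \<open>Dominated convergence of the squared errors turns pointwise limits into limits in
  \<open>L2\<close>. It serves both for disjoint unions of sets and for simple functions.\<close>

lemma rat_approximable_dominated:
  fixes f :: "'a::euclidean_space \<Rightarrow> real"
  assumes f: "f \<in> L2 lborel" and g: "\<And>n. rat_approximable (g n)"
    and lim: "\<And>x. (\<lambda>n. g n x) \<longlonglongrightarrow> f x"
    and h: "integrable lborel h" "\<And>n x. (f x - g n x)\<^sup>2 \<le> h x"
  shows "rat_approximable f"
proof (rule rat_approximable_limit[OF f])
  have [measurable]: "f \<in> borel_measurable lborel" "g n \<in> borel_measurable lborel" for n
    by (rule L2_measurable[OF f], rule L2_measurable[OF rat_approximable_L2[OF g]])
  have "(\<lambda>n. \<integral>x. (f x - g n x)\<^sup>2 \<partial>lborel) \<longlonglongrightarrow> (\<integral>x. 0 \<partial>(lborel :: 'a measure))"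
  proof (rule integral_dominated_convergence)
    show "AE x in lborel. (\<lambda>n. (f x - g n x)\<^sup>2) \<longlonglongrightarrow> 0"
    proof (rule AE_I2)
      fix x
      have "(\<lambda>n. (f x - g n x)\<^sup>2) \<longlonglongrightarrow> (f x - f x)\<^sup>2"
        by (intro tendsto_power tendsto_diff tendsto_const lim)
      then show "(\<lambda>n. (f x - g n x)\<^sup>2) \<longlonglongrightarrow> 0" by simp
    qed
  qed (use h in auto)
  then have lim0: "(\<lambda>n. \<integral>x. (f x - g n x)\<^sup>2 \<partial>lborel) \<longlonglongrightarrow> 0" by simp
  fix \<epsilon> :: real assume "0 < \<epsilon>"
  then have "eventually (\<lambda>n. (\<integral>x. (f x - g n x)\<^sup>2 \<partial>lborel) < \<epsilon>) sequentially"
    using order_tendstoD(2)[OF lim0] by blast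
  then obtain n where "(\<integral>x. (f x - g n x)\<^sup>2 \<partial>lborel) < \<epsilon>"
    by (auto simp: eventually_sequentially)
  then have "ip lborel (\<lambda>x. f x - g n x) (\<lambda>x. f x - g n x) < \<epsilon>" by (simp add: ip_def power2_eq_square)
  then show "\<exists>g. rat_approximable g \<and> ip lborel (\<lambda>x. f x - g x) (\<lambda>x. f x - g x) < \<epsilon>"
    using g by blast
qed

text \<open>Induction over the Dynkin system generated by the basic sets. The fixed ball keeps
  complements square integrable and dominates the partial unions.\<close>

lemma rat_approximable_indicator:
  fixes A :: "'a::euclidean_space set"
  assumes "A \<in> sets borel"
  shows "rat_approximable (indicator (A \<inter> ball 0 (real m)))"
proof -
  let ?b = "ball (0::'a) (real m)"
  have pow: "range basic_set \<subseteq> Pow (UNIV :: 'a set)" by simp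
  have "A \<in> sigma_sets UNIV (range basic_set)" using assms by (simp add: sets_borel_eq_basic_sets)
  then show ?thesis
  proof (induction A rule: sigma_sets_induct_disjoint[OF Int_stable_basic_sets pow,
        consumes 1, case_names basic empty compl union])
    case (basic A)
    then obtain u where "A = basic_set u" by auto
    then show ?case using rat_approximable_basic_fun[of "(u, m)"] by (simp add: basic_fun_def)
  next
    case empty
    then show ?case using rat_approximable_zero by (simp add: indicator_def)
  next
    case (compl A)
    have "rat_approximable (indicator ?b)"
      using rat_approximable_basic_fun[of "([], m)"] by (simp add: basic_fun_def basic_set_def)
    then have "rat_approximable (\<lambda>x. indicator ?b x + (-1) * indicator (A \<inter> ?b) x)"
      using compl by (intro rat_approximable_add rat_approximable_scale)
    moreover have "(\<lambda>x. indicator ?b x + (-1) * indicator (A \<inter> ?b) x) =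
        (indicator ((UNIV - A) \<inter> ?b) :: 'a \<Rightarrow> real)"
      by (auto simp: indicator_def)
    ultimately show ?case by simp
  next
    case (union A)
    have A: "A i \<in> sets borel" for i using union(2) by (auto simp: sets_borel_eq_basic_sets)
    show ?case
    proof (rule rat_approximable_dominated)
      show "indicator ((\<Union>i. A i) \<inter> ?b) \<in> L2 lborel"
        using A by (intro indicator_Int_ball_L2) auto
      show "rat_approximable (\<lambda>x. \<Sum>i<n. indicator (A i \<inter> ?b) x)" for n
        by (intro rat_approximable_sum union)
      have sum: "(\<Sum>i<n. indicator (A i \<inter> ?b) x) = (indicator (\<Union>i<n. A i \<inter> ?b) x :: real)" for n x
        using union(1) by (intro indicator_UN_disjoint[symmetric])
          (auto simp: disjoint_family_on_def)
      show "(\<lambda>n. \<Sum>i<n. indicator (A i \<inter> ?b) x) \<longlonglongrightarrow> (indicator ((\<Union>i. A i) \<inter> ?b) x :: real)" for x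
        unfolding sum using LIMSEQ_indicator_UN[of "\<lambda>i. A i \<inter> ?b" x] by simp
      show "integrable lborel (indicator ?b :: 'a \<Rightarrow> real)"
        using emeasure_bounded_finite[of ?b] by simp
      show "(indicator ((\<Union>i. A i) \<inter> ?b) x - (\<Sum>i<n. indicator (A i \<inter> ?b) x))\<^sup>2 \<le> (indicator ?b x :: real)" for n x
        unfolding sum by (auto simp: indicator_def)
    qed
  qed
qed

lemma L2_rat_approximable:
  fixes f :: "'a::euclidean_space \<Rightarrow> real"
  assumes f: "f \<in> L2 lborel"
  shows "rat_approximable f"
proof -
  \<comment> \<open>Simple functions with
    \<open>\<bar>s i x\<bar> \<le> 2 * \<bar>f x\<bar>\<close>; cut off outside growing balls, they
    stay within \<open>3 * \<bar>f x\<bar>\<close> of \<open>f x\<close>, whence the majorant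
    \<open>9 * (f x)\<^sup>2\<close>.\<close>
  obtain s where s: "\<And>i. simple_function lborel (s i)" "\<And>x. (\<lambda>i. s i x) \<longlonglongrightarrow> f x"
    and bound: "\<And>i x. \<bar>s i x\<bar> \<le> 2 * \<bar>f x\<bar>"
    using borel_measurable_implies_sequence_metric[OF L2_measurable[OF f], of 0] by fastforce
  define g where "g n x = s n x * indicator (ball 0 (real n)) x" for n x
  have g: "rat_approximable (g n)" for n
  proof -
    have fin: "finite (range (s n))" using simple_functionD(1)[OF s(1), of n] by simp
    have "g n x = (\<Sum>y\<in>range (s n). y * indicator (s n -` {y} \<inter> ball 0 (real n)) x)" for x
    proof -
      have "(\<Sum>y\<in>range (s n). y * indicator (s n -` {y} \<inter> ball 0 (real n)) x) =
          (\<Sum>y\<in>range (s n). if y = s n x then y * indicator (ball 0 (real n)) x else 0)"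
        by (intro sum.cong) (auto simp: indicator_def)
      then show ?thesis using fin by (simp add: g_def)
    qed
    then have "g n = (\<lambda>x. \<Sum>y\<in>range (s n). y * indicator (s n -` {y} \<inter> ball 0 (real n)) x)" by auto
    moreover have "s n -` {y} \<in> sets borel" for y
      using simple_functionD(2)[OF s(1), of n "{y}"] by simp
    ultimately show ?thesis
      by (simp only:) (intro rat_approximable_sum rat_approximable_scale rat_approximable_indicator)
  qed
  show ?thesis
  proof (rule rat_approximable_dominated[OF f g])
    fix x :: 'a
    obtain N :: nat where N: "norm x < real N" using reals_Archimedean2 by blast
    have "eventually (\<lambda>n. s n x = g n x) sequentially"
      unfolding eventually_sequentially
      by (rule exI[of _ N]) (use N in \<open>auto simp: g_def indicator_def\<close>)
    then show "(\<lambda>n. g n x) \<longlonglongrightarrow> f x"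
      using s(2)[of x] by (simp add: tendsto_cong)
  next
    show "integrable lborel (\<lambda>x. 9 * (f x)\<^sup>2)" using f by (simp add: L2_def)
  next
    fix n and x :: 'a
    have "\<bar>g n x\<bar> \<le> \<bar>s n x\<bar>" by (simp add: g_def indicator_def)
    then have "\<bar>f x - g n x\<bar> \<le> \<bar>3 * f x\<bar>" using bound[of n x] by linarith
    then have "(f x - g n x)\<^sup>2 \<le> (3 * f x)\<^sup>2" by (simp add: abs_le_square_iff)
    then show "(f x - g n x)\<^sup>2 \<le> 9 * (f x)\<^sup>2" by (simp add: power_mult_distrib)
  qed
qed

text \<open>The rational combinations need not belong to \<open>S\<close>. For every combination and
  every tolerance, a nearby element of \<open>S\<close> is chosen if there is one; these choices are
  countable and dense in \<open>S\<close>.\<close>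

lemma L2_subset_dense_sequence:
  fixes S :: "('a::euclidean_space \<Rightarrow> real) set"
  assumes S: "S \<subseteq> L2 lborel" "S \<noteq> {}"
  obtains d :: "nat \<Rightarrow> 'a \<Rightarrow> real" where "\<And>k. d k \<in> S"
    and "\<And>w \<epsilon>. w \<in> S \<Longrightarrow> \<epsilon> > 0 \<Longrightarrow> \<exists>k. ip lborel (\<lambda>x. w x - d k x) (\<lambda>x. w x - d k x) < \<epsilon>"
proof -
  let ?close = "\<lambda>t p. ip lborel (\<lambda>x. t x - rat_comb (fst p) x) (\<lambda>x. t x - rat_comb (fst p) x)
    < inverse (real (Suc (snd p)))"
  define e where "e p = (if \<exists>t\<in>S. ?close t p then SOME t. t \<in> S \<and> ?close t p else SOME t. t \<in> S)" for p
  have e: "e p \<in> S" for p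
    using someI_ex[of "\<lambda>t. t \<in> S \<and> ?close t p"] some_in_eq[of S] S(2) unfolding e_def by auto
  have e_close: "?close (e p) p" if "t \<in> S" "?close t p" for t p
    using someI_ex[of "\<lambda>t. t \<in> S \<and> ?close t p"] that unfolding e_def by auto
  show ?thesis
  proof (rule that)
    show "e (from_nat k) \<in> S" for k by (rule e)
    fix w and \<epsilon> :: real assume w: "w \<in> S" and \<epsilon>: "\<epsilon> > 0"
    obtain n where n: "inverse (real (Suc n)) < \<epsilon> / 4" using reals_Archimedean[of "\<epsilon> / 4"] \<epsilon> by auto
    have wL: "w \<in> L2 lborel" using w S by auto
    obtain l where l: "?close w (l, n)"
      using L2_rat_approximable[OF wL] unfolding rat_approximable_def
      by (metis fst_conv snd_conv inverse_positive_iff_positive of_nat_0_less_iff zero_less_Suc)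
    have eL: "e (l, n) \<in> L2 lborel" using e S by auto
    have "ip lborel (\<lambda>x. rat_comb l x - e (l, n) x) (\<lambda>x. rat_comb l x - e (l, n) x) =
        ip lborel (\<lambda>x. e (l, n) x - rat_comb l x) (\<lambda>x. e (l, n) x - rat_comb l x)"
      by (simp add: ip_def algebra_simps)
    then have "ip lborel (\<lambda>x. w x - e (l, n) x) (\<lambda>x. w x - e (l, n) x) < \<epsilon>"
      using ip_diff_self_triangle[OF wL rat_comb_L2 eL, of l] l e_close[OF w l] n by simp
    then show "\<exists>k. ip lborel (\<lambda>x. w x - e (from_nat k) x) (\<lambda>x. w x - e (from_nat k) x) < \<epsilon>"
      by (metis from_nat_to_nat)
  qed
qed

text \<open>The members lie in \<open>S\<close> itself and not merely in its closure, so that the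
  estimators and the projection can be tested against them.\<close>

lemma ex_total_orthonormal_sequence:
  fixes S :: "('a::euclidean_space \<Rightarrow> real) set"
  assumes S: "S \<subseteq> L2 lborel" "linear_space_of_functions S"
  obtains \<psi> where "orthonormal_or_zero lborel \<psi>" "\<And>k. \<psi> k \<in> S"
    and "\<And>w. w \<in> S \<Longrightarrow> (\<lambda>k. (ip lborel w (\<psi> k))\<^sup>2) sums ip lborel w w"
proof -
  have "S \<noteq> {}" using S(2) by (auto simp: linear_space_of_functions_def)
  from S(1) this show ?thesis
  proof (rule L2_subset_dense_sequence)
    fix d :: "nat \<Rightarrow> 'a \<Rightarrow> real"
    assume d: "\<And>k. d k \<in> S"
      and dense: "\<And>w \<epsilon>. w \<in> S \<Longrightarrow> \<epsilon> > 0 \<Longrightarrow> \<exists>k. ip lborel (\<lambda>x. w x - d k x) (\<lambda>x. w x - d k x) < \<epsilon>"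
    have dL: "d k \<in> L2 lborel" for k using d S(1) by auto
    show ?thesis
    proof (rule that)
      show "orthonormal_or_zero lborel (gram_schmidt lborel d)" by (rule gram_schmidt_orthonormal[OF dL])
      show "gram_schmidt lborel d k \<in> S" for k by (rule gram_schmidt_in[OF S(2) d])
      show "(\<lambda>k. (ip lborel w (gram_schmidt lborel d k))\<^sup>2) sums ip lborel w w" if "w \<in> S" for w
        using that S(1) by (intro gram_schmidt_parseval dL dense) auto
    qed
  qed
qed

subsection \<open>Block means\<close>

lemma (in prob_space) ip_centered_block_sum:
  fixes Y :: "nat \<Rightarrow> 'a \<Rightarrow> real"
  assumes indep: "indep_vars (\<lambda>_. borel) Y A" and fin: "finite A"
    and Y: "\<And>i. i \<in> A \<Longrightarrow> Y i \<in> L2 M" and centered: "\<And>i. i \<in> A \<Longrightarrow> expectation (Y i) = 0"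
    and var: "\<And>i. i \<in> A \<Longrightarrow> ip M (Y i) (Y i) = v"
  shows "ip M (\<lambda>\<omega>. \<Sum>i\<in>A. Y i \<omega>) (\<lambda>\<omega>. \<Sum>i\<in>A. Y i \<omega>) = real (card A) * v"
proof -
  have one: "(\<lambda>_. 1) \<in> L2 M" by (simp add: L2_def)
  have int: "integrable M (Y i)" if "i \<in> A" for i
    using L2_integrable_mult[OF Y[OF that] one] by simp
  have cross: "ip M (Y i) (Y j) = 0" if "i \<in> A" "j \<in> A" "i \<noteq> j" for i j
  proof -
    have "indep_vars (\<lambda>_. borel) Y {i, j}" using indep that by (auto intro: indep_vars_subset)
    then have "expectation (\<lambda>\<omega>. \<Prod>k\<in>{i, j}. Y k \<omega>) = (\<Prod>k\<in>{i, j}. expectation (Y k))"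
      using that int by (intro indep_vars_lebesgue_integral) auto
    then show ?thesis using that centered by (simp add: ip_def)
  qed
  let ?s = "\<lambda>\<omega>. \<Sum>i\<in>A. Y i \<omega>"
  have s: "?s \<in> L2 M" using Y by (intro L2_sum)
  have "ip M ?s ?s = (\<Sum>i\<in>A. ip M ?s (Y i))"
    using ip_sum_right[OF s, of A Y "\<lambda>_. 1"] Y by simp
  also have "\<dots> = (\<Sum>i\<in>A. v)"
  proof (rule sum.cong[OF refl])
    fix i assume i: "i \<in> A"
    have "ip M (Y i) ?s = (\<Sum>j\<in>A. ip M (Y i) (Y j))"
      using ip_sum_right[OF Y[OF i], of A Y "\<lambda>_. 1"] Y by simp
    also have "\<dots> = (\<Sum>j\<in>A. if j = i then v else 0)"
      using i cross var by (intro sum.cong) auto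
    finally show "ip M ?s (Y i) = v" using i fin by (simp add: ip_commute[of M ?s "Y i"])
  qed
  finally show ?thesis by simp
qed

lemma (in prob_space) L2_comp_density:
  assumes X: "distributed M N X (\<lambda>x. ennreal (s x))" and s: "\<And>x. 0 \<le> s x"
    and t: "t \<in> borel_measurable N" and int: "integrable N (\<lambda>x. s x * (t x)\<^sup>2)"
  shows "(\<lambda>\<omega>. t (X \<omega>)) \<in> L2 M"
    and "ip M (\<lambda>\<omega>. t (X \<omega>)) (\<lambda>\<omega>. t (X \<omega>)) = (\<integral>x. s x * (t x)\<^sup>2 \<partial>N)"
    and "expectation (\<lambda>\<omega>. t (X \<omega>)) = ip N s t"
proof -
  have [measurable]: "X \<in> measurable M N" using X by (rule distributed_measurable)
  note t [measurable]
  have t2: "(\<lambda>x. (t x)\<^sup>2) \<in> borel_measurable N" by measurable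
  show "(\<lambda>\<omega>. t (X \<omega>)) \<in> L2 M"
    using distributed_integrable[OF X t2 s] int by (simp add: L2_def)
  show "ip M (\<lambda>\<omega>. t (X \<omega>)) (\<lambda>\<omega>. t (X \<omega>)) = (\<integral>x. s x * (t x)\<^sup>2 \<partial>N)"
    using distributed_integral[OF X t2 s] by (simp add: ip_def power2_eq_square)
  show "expectation (\<lambda>\<omega>. t (X \<omega>)) = ip N s t"
    using distributed_integral[OF X t s] by (simp add: ip_def)
qed

text \<open>Variance of a mean of independent variables, and non-negativity of the single variance.
  The extended integral prepares the summation over an infinite sequence of functions
  \<open>t\<close>.\<close>

lemma (in prob_space) emp_mean_square_deviation:
  assumes indep: "indep_vars (\<lambda>_. N) X A" and A: "finite A" "A \<noteq> {}"
    and X: "\<And>i. i \<in> A \<Longrightarrow> distributed M N (X i) (\<lambda>x. ennreal (s x))" and s: "\<And>x. 0 \<le> s x"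
    and t: "t \<in> borel_measurable N" and int: "integrable N (\<lambda>x. s x * (t x)\<^sup>2)"
  shows "(\<integral>\<^sup>+\<omega>. ennreal ((emp_mean X A \<omega> t - ip N s t)\<^sup>2) \<partial>M) =
      ennreal (((\<integral>x. s x * (t x)\<^sup>2 \<partial>N) - (ip N s t)\<^sup>2) / real (card A))"
    and "(ip N s t)\<^sup>2 \<le> (\<integral>x. s x * (t x)\<^sup>2 \<partial>N)"
proof -
  let ?p = "ip N s t" and ?v = "(\<integral>x. s x * (t x)\<^sup>2 \<partial>N) - (ip N s t)\<^sup>2"
  define Y where "Y i \<omega> = t (X i \<omega>) - ?p" for i \<omega>
  note tX = L2_comp_density[OF X s t int]
  have c: "(\<lambda>_. ?p) \<in> L2 M" by (simp add: L2_def)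
  have Y: "Y i \<in> L2 M" if "i \<in> A" for i
    unfolding Y_def[abs_def] by (rule L2_diff[OF tX(1)[OF that] c])
  have var: "ip M (Y i) (Y i) = ?v" if "i \<in> A" for i
    unfolding Y_def[abs_def] ip_diff_self[OF tX(1)[OF that] c] tX(2)[OF that]
    using tX(3)[OF that] prob_space by (simp add: ip_def power2_eq_square)
  obtain i where "i \<in> A" using A by auto
  then show "?p\<^sup>2 \<le> (\<integral>x. s x * (t x)\<^sup>2 \<partial>N)" using var ip_self_nonneg[of M "Y i"] by simp
  have int': "integrable M (\<lambda>\<omega>. t (X i \<omega>))" if "i \<in> A" for i
    using L2_integrable_mult[OF tX(1)[OF that], of "\<lambda>_. 1"] by (simp add: L2_def)
  have "indep_vars (\<lambda>_. borel) Y A"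
    unfolding Y_def[abs_def]
    by (intro indep_vars_compose2[OF indep] borel_measurable_diff t borel_measurable_const)
  then have ip: "ip M (\<lambda>\<omega>. \<Sum>i\<in>A. Y i \<omega>) (\<lambda>\<omega>. \<Sum>i\<in>A. Y i \<omega>) = real (card A) * ?v"
    using A(1) Y _ var
  proof (rule ip_centered_block_sum)
    show "expectation (Y i) = 0" if "i \<in> A" for i
      unfolding Y_def[abs_def] using tX(3)[OF that] int'[OF that] prob_space by simp
  qed
  have dev: "emp_mean X A \<omega> t - ?p = 1 / real (card A) * (\<Sum>i\<in>A. Y i \<omega>)" for \<omega>
    using A by (simp add: emp_mean_def Y_def sum_subtractf diff_divide_distrib)
  have L: "(\<lambda>\<omega>. emp_mean X A \<omega> t - ?p) \<in> L2 M"
    unfolding dev by (intro L2_scale L2_sum Y)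
  have "ip M (\<lambda>\<omega>. emp_mean X A \<omega> t - ?p) (\<lambda>\<omega>. emp_mean X A \<omega> t - ?p) = ?v / real (card A)"
    unfolding dev ip_scale_left ip_scale_right ip using A by simp
  then show "(\<integral>\<^sup>+\<omega>. ennreal ((emp_mean X A \<omega> t - ?p)\<^sup>2) \<partial>M) = ennreal (?v / real (card A))"
    using L by (subst nn_integral_eq_integral) (auto simp: L2_def ip_def power2_eq_square)
qed

lemma regular_partition_props:
  assumes "regular_partition n V B" "0 < V" "real V \<le> real n / 2"
  shows "\<And>K. K \<in> {1..V} \<Longrightarrow> B K \<subseteq> {1..n}" "\<And>K. K \<in> {1..V} \<Longrightarrow> finite (B K)"
    and "\<And>K. K \<in> {1..V} \<Longrightarrow> B K \<noteq> {}" "disjoint_family_on B {1..V}"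
    and "(\<Sum>K\<in>{1..V}. card (B K)) = n"
proof -
  show sub: "B K \<subseteq> {1..n}" if "K \<in> {1..V}" for K
    using assms(1) that unfolding regular_partition_def by auto
  then show fin: "finite (B K)" if "K \<in> {1..V}" for K
    using that finite_subset by blast
  show "B K \<noteq> {}" if K: "K \<in> {1..V}" for K
  proof
    assume "B K = {}"
    moreover have "\<bar>real (card (B K)) - real n / real V\<bar> \<le> 1"
      using assms(1) K unfolding regular_partition_def by blast
    ultimately have "real n / real V \<le> 1" by simp
    then have "real n \<le> real V" using assms(2) by (simp add: pos_divide_le_eq)
    then show False using assms(2,3) by simp
  qed
  show disj: "disjoint_family_on B {1..V}" using assms(1) by (simp add: regular_partition_def)
  have "card (\<Union>K\<in>{1..V}. B K) = (\<Sum>K\<in>{1..V}. card (B K))"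
    by (rule card_UN_disjoint'[OF disj]) (auto intro: fin)
  then show "(\<Sum>K\<in>{1..V}. card (B K)) = n"
    using assms(1) by (simp add: regular_partition_def)
qed

text \<open>On \<open>[b - 1, b + 1]\<close> the convex function \<open>b / y\<close> lies below its chord
  \<open>b (2 b - y) / (b\<^sup>2 - 1)\<close>, so its mean over the block sizes is at most \<open>b\<^sup>2 / (b\<^sup>2 - 1) \<le> 4 / 3\<close>.\<close>

lemma regular_partition_prod_le:
  assumes reg: "regular_partition n V B" and V: "0 < V" "real V \<le> real n / 2"
  shows "(\<Prod>K\<in>{1..V}. 1 + 3/4 * (real n / (real V * real (card (B K))))) \<le> 2 ^ V"
proof -
  note B = regular_partition_props[OF reg V]
  define b where "b = real n / real V"
  have b2: "2 \<le> b" using V by (simp add: b_def field_simps)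
  then have b: "0 < b\<^sup>2 - 1" "b\<^sup>2 / (b\<^sup>2 - 1) \<le> 4/3"
    using power_mono[of 2 b 2] by (simp_all add: field_simps)
  define y where "y K = real (card (B K))" for K
  have y: "0 < y K" "\<bar>y K - b\<bar> \<le> 1" if "K \<in> {1..V}" for K
    using B(2,3)[OF that] reg that unfolding regular_partition_def
    by (auto simp: y_def b_def card_gt_0_iff)
  have sumy: "(\<Sum>K\<in>{1..V}. y K) = real V * b"
    using B(5) V unfolding y_def b_def by (simp flip: of_nat_sum)
  have chord: "b / y K \<le> b * (2 * b - y K) / (b\<^sup>2 - 1)" if K: "K \<in> {1..V}" for K
  proof -
    \<comment> \<open>The chord inequality amounts to this, since
      \<open>(2 * b - y K) * y K = b\<^sup>2 - (y K - b)\<^sup>2\<close>.\<close>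
    have "(y K - b)\<^sup>2 \<le> 1" using y(2)[OF K] by (simp add: abs_square_le_1)
    then have "b\<^sup>2 - 1 \<le> (2 * b - y K) * y K" by (simp add: power2_eq_square algebra_simps)
    then have "b * (b\<^sup>2 - 1) \<le> b * ((2 * b - y K) * y K)" using b2 by (intro mult_left_mono) auto
    then show ?thesis using b y(1)[OF K] by (simp add: field_simps)
  qed
  have "(\<Sum>K\<in>{1..V}. b / y K) \<le> (\<Sum>K\<in>{1..V}. b * (2 * b - y K) / (b\<^sup>2 - 1))"
    by (intro sum_mono chord)
  also have "\<dots> = b * (2 * real V * b - (\<Sum>K\<in>{1..V}. y K)) / (b\<^sup>2 - 1)"
    by (simp add: sum_divide_distrib[symmetric] sum_distrib_left[symmetric] sum_subtractf)
  also have "\<dots> = real V * (b\<^sup>2 / (b\<^sup>2 - 1))"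
    unfolding sumy by (simp add: power2_eq_square)
  also have "\<dots> \<le> real V * (4/3)" using b by (intro mult_left_mono) auto
  finally have sum: "(\<Sum>K\<in>{1..V}. b / y K) \<le> real V * (4/3)" .
  \<comment> \<open>\<open>1 + z \<le> exp z\<close> after factoring out 2. The exponents vanish at
    \<open>b / y K = 4/3\<close>, the bound on the mean, so their sum is at most 0.\<close>
  have "(\<Prod>K\<in>{1..V}. 1 + 3/4 * (b / y K)) \<le> (\<Prod>K\<in>{1..V}. 2 * exp (3/8 * (b / y K) - 1/2))"
  proof (intro prod_mono conjI)
    fix K assume "K \<in> {1..V}"
    then show "0 \<le> 1 + 3/4 * (b / y K)" using y(1)[of K] b2 by simp
    show "1 + 3/4 * (b / y K) \<le> 2 * exp (3/8 * (b / y K) - 1/2)"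
      using exp_ge_add_one_self[of "3/8 * (b / y K) - 1/2"] by simp
  qed
  also have "\<dots> = 2 ^ V * exp (\<Sum>K\<in>{1..V}. 3/8 * (b / y K) - 1/2)"
    by (simp add: prod.distrib exp_sum)
  also have "(\<Sum>K\<in>{1..V}. 3/8 * (b / y K) - 1/2) = 3/8 * (\<Sum>K\<in>{1..V}. b / y K) - real V / 2"
    by (simp add: sum_subtractf sum_distrib_left)
  also have "2 ^ V * exp (3/8 * (\<Sum>K\<in>{1..V}. b / y K) - real V / 2) \<le> 2 ^ V * 1"
    using sum by (intro mult_left_mono) auto
  finally show ?thesis by (simp add: b_def y_def)
qed

text \<open>Markov's inequality for a product whose mean factorizes by independence.\<close>

lemma (in prob_space) prob_prod_affine_ge:
  fixes Z :: "'i \<Rightarrow> 'a \<Rightarrow> ennreal"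
  assumes indep: "indep_vars (\<lambda>_. borel) Z I" and fin: "finite I"
    and Z: "\<And>J. J \<in> I \<Longrightarrow> (\<integral>\<^sup>+\<omega>. Z J \<omega> \<partial>M) \<le> ennreal (m J)"
    and m: "\<And>J. J \<in> I \<Longrightarrow> 0 \<le> m J" and c: "0 \<le> c" and G: "0 < G"
  shows "{\<omega>\<in>space M. ennreal G \<le> (\<Prod>J\<in>I. 1 + ennreal c * Z J \<omega>)} \<in> events"
    and "emeasure M {\<omega>\<in>space M. ennreal G \<le> (\<Prod>J\<in>I. 1 + ennreal c * Z J \<omega>)} \<le>
      ennreal ((\<Prod>J\<in>I. 1 + c * m J) / G)"
proof -
  have Zm [measurable]: "Z J \<in> borel_measurable M" if "J \<in> I" for J
    using indep that by (auto simp: indep_vars_def2)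
  let ?W = "\<lambda>\<omega>. \<Prod>J\<in>I. 1 + ennreal c * Z J \<omega>"
  have W: "?W \<in> borel_measurable M" by (intro borel_measurable_prod_ennreal) measurable
  have eq: "{\<omega>\<in>space M. ennreal G \<le> ?W \<omega>} = {\<omega>\<in>space M. 1 \<le> ennreal (1 / G) * ?W \<omega>}"
  proof -
    have "(ennreal G \<le> w) = (1 \<le> ennreal (1 / G) * w)" for w
    proof (cases w)
      case (real r)
      then show ?thesis using G by (simp add: ennreal_mult[symmetric] pos_le_divide_eq)
    next
      case top
      then show ?thesis using G by (simp add: ennreal_mult_top)
    qed
    then show ?thesis by simp
  qed
  show "{\<omega>\<in>space M. ennreal G \<le> ?W \<omega>} \<in> events" using W by measurable
  have "emeasure M {\<omega>\<in>space M. 1 \<le> ennreal (1 / G) * ?W \<omega>} \<le> ennreal (1 / G) * (\<integral>\<^sup>+\<omega>. ?W \<omega> \<partial>M)"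
  proof -
    have "(\<integral>\<^sup>+\<omega>\<in>space M. ?W \<omega> \<partial>M) = (\<integral>\<^sup>+\<omega>. ?W \<omega> \<partial>M)"
      by (intro nn_integral_cong) simp
    moreover have "(\<lambda>\<omega>. ?W \<omega> * indicator (space M) \<omega>) \<in> borel_measurable M"
      using W by measurable
    ultimately show ?thesis
      using nn_integral_Markov_inequality[of ?W "space M" M "ennreal (1 / G)"] by simp
  qed
  also have "(\<integral>\<^sup>+\<omega>. ?W \<omega> \<partial>M) = (\<Prod>J\<in>I. \<integral>\<^sup>+\<omega>. 1 + ennreal c * Z J \<omega> \<partial>M)"
    by (intro indep_vars_nn_integral fin indep_vars_compose2[OF indep]) auto
  also have "\<dots> \<le> (\<Prod>J\<in>I. ennreal (1 + c * m J))"
  proof (rule prod_mono_ennreal)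
    fix J assume J: "J \<in> I"
    have "(\<integral>\<^sup>+\<omega>. 1 + ennreal c * Z J \<omega> \<partial>M) = 1 + ennreal c * (\<integral>\<^sup>+\<omega>. Z J \<omega> \<partial>M)"
      using J emeasure_space_1 by (subst nn_integral_add) (auto simp: nn_integral_cmult)
    also have "\<dots> \<le> 1 + ennreal c * ennreal (m J)"
      using Z[OF J] by (intro add_left_mono mult_left_mono) auto
    also have "\<dots> = ennreal (1 + c * m J)"
      using c m[OF J] by (simp add: ennreal_mult ennreal_plus)
    finally show "(\<integral>\<^sup>+\<omega>. 1 + ennreal c * Z J \<omega> \<partial>M) \<le> ennreal (1 + c * m J)" .
  qed
  also have "\<dots> = ennreal (\<Prod>J\<in>I. 1 + c * m J)"
    using c m by (intro prod_ennreal) auto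
  also have "ennreal (1 / G) * \<dots> = ennreal ((\<Prod>J\<in>I. 1 + c * m J) / G)"
    using G c m by (subst ennreal_mult[symmetric]) (auto intro!: prod_nonneg)
  finally show "emeasure M {\<omega>\<in>space M. ennreal G \<le> ?W \<omega>} \<le> ennreal ((\<Prod>J\<in>I. 1 + c * m J) / G)"
    unfolding eq by (simp add: mult_left_mono)
qed

subsection \<open>The function \<open>\<Psi>\<close>\<close>

text \<open>For fixed \<open>x\<close> with sum \<open>q > 0\<close>, the witness is the combination
  with coefficients \<open>\<psi> k x / sqrt q\<close>: its norm is at most 1 and its value at
  \<open>x\<close> is \<open>sqrt q\<close>.\<close>

lemma sum_squares_le_Psi:
  assumes \<psi>: "orthonormal_or_zero \<mu> \<psi>" "\<And>k. \<psi> k \<in> S" and S: "linear_space_of_functions S"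
  shows "ennreal (\<Sum>k<N. (\<psi> k x)\<^sup>2) \<le> Psi \<mu> S x"
proof (cases "(\<Sum>k<N. (\<psi> k x)\<^sup>2) = 0")
  case False
  define q where "q = (\<Sum>k<N. (\<psi> k x)\<^sup>2)"
  have q: "0 < q" using False sum_nonneg[of "{..<N}" "\<lambda>k. (\<psi> k x)\<^sup>2"] by (simp add: q_def less_le)
  define t where "t y = (\<Sum>k<N. (\<psi> k x / sqrt q) * \<psi> k y)" for y
  have t: "t \<in> S" unfolding t_def[abs_def] by (intro linear_space_sum[OF S] \<psi>) simp
  have "ip \<mu> t t \<le> (\<Sum>k<N. (\<psi> k x / sqrt q)\<^sup>2)"
    unfolding t_def[abs_def] by (rule orthonormal_ip_sum_self_le[OF \<psi>(1)])
  also have "\<dots> = 1" using q by (simp add: power_divide sum_divide_distrib[symmetric] flip: q_def)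
  finally have "norm2 \<mu> t \<le> 1"
    using norm2_power2[of \<mu> t] abs_square_le_1[of "norm2 \<mu> t"] by simp
  moreover have "t x = (\<Sum>k<N. (\<psi> k x)\<^sup>2) / sqrt q"
    by (simp add: t_def sum_divide_distrib power2_eq_square)
  then have "(t x)\<^sup>2 = q" using q by (simp add: power_divide flip: q_def) (simp add: power2_eq_square)
  ultimately show ?thesis
    unfolding Psi_def using t by (intro SUP_upper2[of t]) (auto simp: q_def)
qed simp

lemma integral_orthonormal_squares_le:
  assumes \<psi>: "orthonormal_or_zero \<mu> \<psi>" "\<And>k. \<psi> k \<in> S" and S: "linear_space_of_functions S"
    and s: "s \<in> borel_measurable \<mu>" "\<And>x. 0 \<le> s x" and P: "P_Psi \<mu> s S = ennreal p" "0 \<le> p"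
  shows "integrable \<mu> (\<lambda>x. s x * (\<psi> k x)\<^sup>2)" (is "?int k")
    and "(\<Sum>k<N. \<integral>x. s x * (\<psi> k x)\<^sup>2 \<partial>\<mu>) \<le> p"
proof -
  have [measurable]: "s \<in> borel_measurable \<mu>" "\<psi> k \<in> borel_measurable \<mu>" for k
    by (rule s(1), rule L2_measurable[OF orthonormal_or_zero_L2[OF \<psi>(1)]])
  have le: "(\<integral>\<^sup>+x. ennreal (\<Sum>k<N. s x * (\<psi> k x)\<^sup>2) \<partial>\<mu>) \<le> ennreal p" for N
  proof -
    have "(\<integral>\<^sup>+x. ennreal (\<Sum>k<N. s x * (\<psi> k x)\<^sup>2) \<partial>\<mu>) \<le> P_Psi \<mu> s S"
      unfolding P_Psi_def
    proof (rule nn_integral_mono)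
      fix x
      have "ennreal (\<Sum>k<N. s x * (\<psi> k x)\<^sup>2) = ennreal (\<Sum>k<N. (\<psi> k x)\<^sup>2) * ennreal (s x)"
        using s(2) by (simp add: sum_distrib_left[symmetric] ennreal_mult[symmetric] sum_nonneg mult.commute)
      also have "\<dots> \<le> Psi \<mu> S x * ennreal (s x)"
        by (intro mult_right_mono sum_squares_le_Psi[OF \<psi> S]) simp
      finally show "ennreal (\<Sum>k<N. s x * (\<psi> k x)\<^sup>2) \<le> Psi \<mu> S x * ennreal (s x)" .
    qed
    then show ?thesis using P by simp
  qed
  show int: "?int k" for k
  proof (rule integrableI_nonneg)
    have "(\<integral>\<^sup>+x. ennreal (s x * (\<psi> k x)\<^sup>2) \<partial>\<mu>) \<le> (\<integral>\<^sup>+x. ennreal (\<Sum>k<Suc k. s x * (\<psi> k x)\<^sup>2) \<partial>\<mu>)"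
      using s(2) by (intro nn_integral_mono ennreal_leI) (simp add: sum_nonneg)
    also have "\<dots> \<le> ennreal p" by (rule le)
    finally show "(\<integral>\<^sup>+x. ennreal (s x * (\<psi> k x)\<^sup>2) \<partial>\<mu>) < \<infinity>"
      by (simp add: le_less_trans)
  qed (use s(2) in auto)
  have "ennreal (\<integral>x. (\<Sum>k<N. s x * (\<psi> k x)\<^sup>2) \<partial>\<mu>) = (\<integral>\<^sup>+x. ennreal (\<Sum>k<N. s x * (\<psi> k x)\<^sup>2) \<partial>\<mu>)"
    using int s(2) by (intro nn_integral_eq_integral[symmetric]) (auto intro!: sum_nonneg)
  then have "ennreal (\<integral>x. (\<Sum>k<N. s x * (\<psi> k x)\<^sup>2) \<partial>\<mu>) \<le> ennreal p"
    using le[of N] by (simp only:)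
  then have "(\<integral>x. (\<Sum>k<N. s x * (\<psi> k x)\<^sup>2) \<partial>\<mu>) \<le> p"
    by (simp only: ennreal_le_iff[OF P(2)])
  then show "(\<Sum>k<N. \<integral>x. s x * (\<psi> k x)\<^sup>2 \<partial>\<mu>) \<le> p" using int by simp
qed

subsection \<open>Projection estimators\<close>

lemma emp_mean_diff: "emp_mean X A \<omega> (\<lambda>x. f x - g x) = emp_mean X A \<omega> f - emp_mean X A \<omega> g"
  by (simp add: emp_mean_def sum_subtractf diff_divide_distrib)

lemma emp_mean_add: "emp_mean X A \<omega> (\<lambda>x. f x + g x) = emp_mean X A \<omega> f + emp_mean X A \<omega> g"
  by (simp add: emp_mean_def sum.distrib add_divide_distrib)

lemma emp_mean_scale: "emp_mean X A \<omega> (\<lambda>x. c * f x) = c * emp_mean X A \<omega> f"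
  by (simp add: emp_mean_def sum_distrib_left)

lemma emp_mean_contrast:
  assumes "finite A" "A \<noteq> {}"
  shows "emp_mean X A \<omega> (contrast \<mu> t) = ip \<mu> t t - 2 * emp_mean X A \<omega> t"
proof -
  have "emp_mean X A \<omega> (\<lambda>x. ip \<mu> t t) = ip \<mu> t t"
    using assms by (simp add: emp_mean_def)
  then show ?thesis
    unfolding contrast_def[abs_def] norm2_power2 by (simp add: emp_mean_diff emp_mean_scale)
qed

text \<open>The normal equations: along \<open>f + c * t\<close> the contrast is a quadratic in
  \<open>c\<close> with minimum at 0, so its linear coefficient vanishes. Thus \<open>f\<close>
  represents the empirical mean on \<open>S\<close>.\<close>

lemma emp_contrast_minimizer:
  assumes S: "S \<subseteq> L2 \<mu>" "linear_space_of_functions S" and A: "finite A" "A \<noteq> {}"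
    and min: "is_arg_min (\<lambda>t. emp_mean X A \<omega> (contrast \<mu> t)) (\<lambda>t. t \<in> S) f" and t: "t \<in> S"
  shows "f \<in> S" "ip \<mu> f t = emp_mean X A \<omega> t"
proof -
  show f: "f \<in> S" using min by (simp add: is_arg_min_def)
  have L: "f \<in> L2 \<mu>" "t \<in> L2 \<mu>" using f t S by auto
  define d where "d = ip \<mu> f t - emp_mean X A \<omega> t"
  have q: "0 \<le> 2 * c * d + c\<^sup>2 * ip \<mu> t t" for c
  proof -
    have "(\<lambda>x. f x + c * t x) \<in> S" by (intro linear_space_add[OF S(2) f] linear_space_scale[OF S(2) t])
    then have "emp_mean X A \<omega> (contrast \<mu> f) \<le> emp_mean X A \<omega> (contrast \<mu> (\<lambda>x. f x + c * t x))"
      using min by (auto simp: is_arg_min_def not_less)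
    then show ?thesis
      unfolding emp_mean_contrast[OF A] emp_mean_add emp_mean_scale
        ip_add_self[OF L(1) L2_scale[OF L(2)]] ip_scale_left ip_scale_right d_def
      by (simp add: algebra_simps power2_eq_square)
  qed
  have "d = 0"
  proof (rule ccontr)
    assume "d \<noteq> 0"
    \<comment> \<open>The added 1 allows the division also when \<open>t\<close> is null.\<close>
    define k where "k = ip \<mu> t t + 1"
    have k: "0 < k" "ip \<mu> t t < k" using ip_self_nonneg[of \<mu> t] by (auto simp: k_def)
    have "0 \<le> 2 * (- d / k) * d + (- d / k)\<^sup>2 * ip \<mu> t t" by (rule q)
    also have "\<dots> < 2 * (- d / k) * d + (- d / k)\<^sup>2 * k"
      using k \<open>d \<noteq> 0\<close> by (intro add_strict_left_mono mult_strict_left_mono) auto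
    also have "\<dots> = - d\<^sup>2 / k" using k by (simp add: power2_eq_square field_simps)
    also have "\<dots> \<le> 0" using k by simp
    finally show False by simp
  qed
  then show "ip \<mu> f t = emp_mean X A \<omega> t" by (simp add: d_def)
qed

text \<open>The failure event is built from \<open>shat\<close>, \<open>Pbar\<close> and
  \<open>Kstar\<close>, which carry no measurability; it is covered by a measurable event up to a
  null set.\<close>

lemma outer_measure_of_le_AE:
  assumes "AE x in M. x \<in> A \<longrightarrow> x \<in> E" "E \<in> sets M" "A \<subseteq> space M"
  shows "outer_measure_of M A \<le> emeasure M E"
proof -
  obtain N where N: "{x \<in> space M. \<not> (x \<in> A \<longrightarrow> x \<in> E)} \<subseteq> N" "emeasure M N = 0" "N \<in> sets M"
    using AE_E[OF assms(1)] by blast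
  have "outer_measure_of M A \<le> outer_measure_of M (E \<union> N)"
    using N(1) assms(3) by (intro outer_measure_of_mono) auto
  also have "\<dots> = emeasure M E"
    using N assms(2) by (simp add: emeasure_Un_null_set null_setsI)
  finally show ?thesis .
qed

text \<open>Each deviation is a measurable function of the observations in its own block;
  \<open>?F\<close> writes it on the product space, with the coordinates in place of
  \<open>X\<close>.\<close>

lemma (in prob_space) indep_vars_block_deviation:
  fixes X :: "nat \<Rightarrow> 'a \<Rightarrow> 'b::topological_space"
  assumes indep: "indep_vars (\<lambda>_. borel) X I" and B: "\<And>J. J \<in> L \<Longrightarrow> B J \<subseteq> I"
    and disj: "disjoint_family_on B L" and \<psi>: "\<And>k. \<psi> k \<in> borel_measurable borel"
  shows "indep_vars (\<lambda>_. borel) (\<lambda>J \<omega>. \<Sum>k. ennreal ((emp_mean X (B J) \<omega> (\<psi> k) - p k)\<^sup>2)) L"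
proof -
  let ?F = "\<lambda>J y. \<Sum>k. ennreal ((emp_mean (\<lambda>i y. y i) (B J) y (\<psi> k) - p k)\<^sup>2)"
  note \<psi> [measurable]
  have "indep_vars (\<lambda>_. borel) (\<lambda>J \<omega>. ?F J (restrict (\<lambda>i. X i \<omega>) (B J))) L"
  proof (rule indep_vars_compose2[OF indep_vars_restrict[OF indep B disj]])
    show "?F J \<in> borel_measurable (PiM (B J) (\<lambda>_. borel))" for J
      unfolding emp_mean_def by measurable
  qed
  also have "(\<lambda>J \<omega>. ?F J (restrict (\<lambda>i. X i \<omega>) (B J))) =
      (\<lambda>J \<omega>. \<Sum>k. ennreal ((emp_mean X (B J) \<omega> (\<psi> k) - p k)\<^sup>2))"
    by (simp add: emp_mean_def cong: sum.cong)
  finally show ?thesis .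
qed

subsection \<open>The risk bound\<close>

text \<open>For \<open>h\<close> the estimator of a block, \<open>ip \<mu> h f\<close> is the
  empirical mean of \<open>f\<close> there. Centering at \<open>u\<close> leaves only twice the
  inner product of \<open>h - u\<close> with \<open>g - f\<close>, to which Cauchy--Schwarz
  applies.\<close>

lemma abs_contrast_diff_le:
  assumes "f \<in> L2 \<mu>" "g \<in> L2 \<mu>" "h \<in> L2 \<mu>" "u \<in> L2 \<mu>"
  shows "\<bar>(ip \<mu> f f - 2 * ip \<mu> h f) - (ip \<mu> g g - 2 * ip \<mu> h g) -
      ((norm2 \<mu> (\<lambda>x. f x - u x))\<^sup>2 - (norm2 \<mu> (\<lambda>x. g x - u x))\<^sup>2)\<bar> \<le>
    2 * norm2 \<mu> (\<lambda>x. h x - u x) * (norm2 \<mu> (\<lambda>x. f x - u x) + norm2 \<mu> (\<lambda>x. g x - u x))"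
proof -
  have fu: "(\<lambda>x. f x - u x) \<in> L2 \<mu>" and gu: "(\<lambda>x. g x - u x) \<in> L2 \<mu>" and hu: "(\<lambda>x. h x - u x) \<in> L2 \<mu>"
    using assms by (auto intro: L2_diff)
  have "(ip \<mu> f f - 2 * ip \<mu> h f) - (ip \<mu> g g - 2 * ip \<mu> h g) -
      ((norm2 \<mu> (\<lambda>x. f x - u x))\<^sup>2 - (norm2 \<mu> (\<lambda>x. g x - u x))\<^sup>2) =
    2 * ip \<mu> (\<lambda>x. h x - u x) (\<lambda>x. g x - u x) - 2 * ip \<mu> (\<lambda>x. h x - u x) (\<lambda>x. f x - u x)"
    using assms hu
    by (simp add: norm2_power2 ip_diff_self ip_diff_right ip_diff_left
        ip_commute[of \<mu> u f] ip_commute[of \<mu> u g] ip_commute[of \<mu> u h])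
  then show ?thesis
    using abs_ip_le_norm2[OF hu fu] abs_ip_le_norm2[OF hu gu] by (simp add: distrib_left)
qed

theorem proposition11:
  fixes M :: "'w measure"
    and X :: "nat \<Rightarrow> 'w \<Rightarrow> 'a::euclidean_space"
    and s so :: "'a \<Rightarrow> real"
    and S :: "('a \<Rightarrow> real) set"
    and \<delta> :: real
    and n V :: nat
    and B :: "nat \<Rightarrow> nat set"
    and shat :: "nat \<Rightarrow> 'w \<Rightarrow> 'a \<Rightarrow> real"
    and Pbar :: "nat \<Rightarrow> nat \<Rightarrow> 'w \<Rightarrow> real"
    and Kstar :: "'w \<Rightarrow> nat"
  assumes "prob_space M"
    and "prob_space.indep_vars M (\<lambda>_. borel) X {1..n}"
    and "\<And>i. i \<in> {1..n} \<Longrightarrow> distributed M lborel (X i) (\<lambda>x. ennreal (s x))"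
    and "\<And>x. s x \<ge> 0"
    and "s \<in> L2 lborel"
    and "S \<subseteq> L2 lborel"
    and "linear_space_of_functions S"
    and "is_orth_proj lborel S s so"
    and "\<delta> > 0"
    and "real_of_int \<lceil>ln (\<delta> powi (- 2))\<rceil> \<le> real n / 2"
    and "V = nat (max \<lceil>ln (\<delta> powi (- 2))\<rceil> 8)"
    and "real V \<le> real n / 2"
    and "regular_partition n V B"
    and "AE \<omega> in M. \<forall>K\<in>{1..V}.
           is_arg_min (\<lambda>t. emp_mean X (B K) \<omega> (contrast lborel t)) (\<lambda>t. t \<in> S) (shat K \<omega>)"
    and "\<And>\<omega> K K'. \<omega> \<in> space M \<Longrightarrow> K \<in> {1..V} \<Longrightarrow> K' \<in> {1..V} \<Longrightarrow>
           is_median ({1..V} - {K, K'})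
             (\<lambda>J. emp_mean X (B J) \<omega>
                (\<lambda>x. contrast lborel (shat K \<omega>) x - contrast lborel (shat K' \<omega>) x))
             (Pbar K K' \<omega>)"
    and "\<And>\<omega>. \<omega> \<in> space M \<Longrightarrow>
           is_arg_min (\<lambda>K. MAX K'\<in>{1..V}. Pbar K K' \<omega>) (\<lambda>K. K \<in> {1..V}) (Kstar \<omega>)"
  shows "outer_measure_of M
           {\<omega> \<in> space M.
              ereal ((norm2 lborel (\<lambda>x. shat (Kstar \<omega>) \<omega> x - s x))\<^sup>2)
              > ereal ((norm2 lborel (\<lambda>x. so x - s x))\<^sup>2)
                + ereal L5_const * (enn2ereal (P_Psi lborel s S) - ereal ((norm2 lborel so)\<^sup>2))
                  * ereal (real V / real n)}
         \<le> ennreal (2 * \<delta>)"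
proof -
  interpret prob_space M by fact
  note indep = assms(2) and X = assms(3) and s = assms(4) and sL = assms(5) and S = assms(6,7)
    and proj = assms(8) and reg = assms(13) and shat = assms(14) and Pbar = assms(15)
    and Kstar = assms(16)
  let ?ip = "ip lborel"
  have V8: "8 \<le> V" using assms(11) by simp
  then have V: "0 < V" by simp
  have n: "0 < n" using assms(12) V by simp
  note B = regular_partition_props[OF reg V assms(12)]
  have L5: "0 < L5_const" "80.66 \<le> L5_const" using L5_const_lower by auto
  show ?thesis (is "outer_measure_of M ?bad \<le> _")
  \<comment> \<open>An infinite mean makes the threshold infinite, so the failure event is
    empty.\<close>
  proof (cases "P_Psi lborel s S = \<infinity>")
    case True
    then have bad: "?bad = {}" using L5 V n by simp
    show ?thesis unfolding bad by simp
  next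
    case False
    then obtain p where p: "P_Psi lborel s S = ennreal p" "0 \<le> p"
      by (metis ennreal_cases infinity_ennreal_def)
    have so: "so \<in> S" and so_proj: "\<And>t. t \<in> S \<Longrightarrow> ?ip s t = ?ip so t"
    proof -
      show so: "so \<in> S" using proj by (simp add: is_orth_proj_def)
      fix t assume t: "t \<in> S"
      then have "?ip (\<lambda>x. s x - so x) t = 0" using proj by (simp add: is_orth_proj_def ip_def)
      moreover have "t \<in> L2 lborel" "so \<in> L2 lborel" using t so S by auto
      ultimately show "?ip s t = ?ip so t" using sL by (simp add: ip_diff_left)
    qed
    have SL: "t \<in> L2 lborel" if "t \<in> S" for t using S(1) that by (rule subsetD)

    \<comment> \<open>Expected squared error of a block\<close>
    define D where "D = p - ?ip so so"
    obtain \<psi> :: "nat \<Rightarrow> 'a \<Rightarrow> real" where on: "orthonormal_or_zero lborel \<psi>" and \<psi>: "\<And>k. \<psi> k \<in> S"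
      and total: "\<And>w. w \<in> S \<Longrightarrow> (\<lambda>k. (?ip w (\<psi> k))\<^sup>2) sums ?ip w w"
      using ex_total_orthonormal_sequence[OF S] by blast
    have s_borel: "s \<in> borel_measurable lborel" using sL by (rule L2_measurable)
    have \<psi>_borel: "\<psi> k \<in> borel_measurable lborel" for k using SL[OF \<psi>] by (rule L2_measurable)
    note int = integral_orthonormal_squares_le(1)[OF on \<psi> S(2) s_borel s p]
    define v where "v k = (\<integral>x. s x * (\<psi> k x)\<^sup>2 \<partial>lborel) - (?ip s (\<psi> k))\<^sup>2" for k
    \<comment> \<open>Defined through empirical means, \<open>Z J\<close> is measurable and
      independent over blocks. It agrees almost surely with the squared error of
      \<open>shat J\<close>, which is only shown later.\<close>
    define Z where "Z J \<omega> = (\<Sum>k. ennreal ((emp_mean X (B J) \<omega> (\<psi> k) - ?ip s (\<psi> k))\<^sup>2))" for J \<omega>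
    have dev: "(\<integral>\<^sup>+\<omega>. ennreal ((emp_mean X (B J) \<omega> (\<psi> k) - ?ip s (\<psi> k))\<^sup>2) \<partial>M) =
        ennreal (v k / real (card (B J)))" "0 \<le> v k" if J: "J \<in> {1..V}" for J k
    proof -
      have ind: "indep_vars (\<lambda>_. lborel) X (B J)"
        using indep_vars_subset[OF indep B(1)[OF J]] by (simp add: indep_vars_def2)
      have dist: "\<And>i. i \<in> B J \<Longrightarrow> distributed M lborel (X i) (\<lambda>x. ennreal (s x))"
        using X B(1)[OF J] by auto
      note * = emp_mean_square_deviation[OF ind B(2)[OF J] B(3)[OF J] dist s \<psi>_borel int]
      show "(\<integral>\<^sup>+\<omega>. ennreal ((emp_mean X (B J) \<omega> (\<psi> k) - ?ip s (\<psi> k))\<^sup>2) \<partial>M) =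
        ennreal (v k / real (card (B J)))" "0 \<le> v k"
        using *[of k] by (simp_all add: v_def)
    qed
    have v0: "0 \<le> v k" for k using dev(2)[of 1 k] V by simp
    \<comment> \<open>The squared coefficients of \<open>so\<close> reach \<open>?ip so so\<close>
      only in the limit, so the sum is first enlarged to \<open>m \<ge> N\<close> terms and then
      \<open>m\<close> tends to infinity.\<close>
    have v_sum: "(\<Sum>k<N. v k) \<le> D" for N
    proof -
      have "(\<lambda>m. p - (\<Sum>k<m. (?ip so (\<psi> k))\<^sup>2)) \<longlonglongrightarrow> p - ?ip so so"
        using total[OF so] by (intro tendsto_diff tendsto_const) (simp add: sums_def)
      moreover have "(\<Sum>k<N. v k) \<le> p - (\<Sum>k<m. (?ip so (\<psi> k))\<^sup>2)" if "N \<le> m" for m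
      proof -
        have "(\<Sum>k<N. v k) \<le> (\<Sum>k<m. v k)" using that v0 by (intro sum_mono2) auto
        also have "\<dots> \<le> p - (\<Sum>k<m. (?ip so (\<psi> k))\<^sup>2)"
          using integral_orthonormal_squares_le(2)[OF on \<psi> S(2) s_borel s p, of m]
          by (simp add: v_def sum_subtractf so_proj[OF \<psi>])
        finally show ?thesis .
      qed
      ultimately show ?thesis unfolding D_def by (intro LIMSEQ_le_const) auto
    qed
    have D0: "0 \<le> D" using v_sum[of 0] by simp
    have indepZ: "indep_vars (\<lambda>_. borel) Z {1..V}"
      unfolding Z_def[abs_def] using \<psi>_borel
      by (intro indep_vars_block_deviation[OF indep] B) auto
    have Z_le: "(\<integral>\<^sup>+\<omega>. Z J \<omega> \<partial>M) \<le> ennreal (D / real (card (B J)))" if J: "J \<in> {1..V}" for J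
    proof -
      have meas: "(\<lambda>\<omega>. ennreal ((emp_mean X (B J) \<omega> (\<psi> k) - ?ip s (\<psi> k))\<^sup>2)) \<in> borel_measurable M" for k
      proof -
        have [measurable]: "X i \<in> borel_measurable M" if "i \<in> B J" for i
          using indep B(1)[OF J] that by (auto simp: indep_vars_def2)
        have [measurable]: "\<psi> k \<in> borel_measurable borel" using \<psi>_borel[of k] by simp
        show ?thesis unfolding emp_mean_def by measurable
      qed
      have "(\<integral>\<^sup>+\<omega>. Z J \<omega> \<partial>M) = (\<Sum>k. ennreal (v k / real (card (B J))))"
        unfolding Z_def using meas by (simp add: nn_integral_suminf dev(1)[OF J])
      also have "\<dots> \<le> ennreal (D / real (card (B J)))"
      proof (rule suminf_le_const[OF summableI])
        fix N
        have "(\<Sum>k<N. ennreal (v k / real (card (B J)))) = ennreal ((\<Sum>k<N. v k) / real (card (B J)))"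
          using v0 by (simp add: sum_divide_distrib)
        also have "\<dots> \<le> ennreal (D / real (card (B J)))"
          by (intro ennreal_leI divide_right_mono v_sum) simp
        finally show "(\<Sum>k<N. ennreal (v k / real (card (B J)))) \<le> ennreal (D / real (card (B J)))" .
      qed
      finally show ?thesis .
    qed

    \<comment> \<open>Identification of the errors and of the failure event\<close>
    define a where "a J \<omega> = (\<lambda>x. shat J \<omega> x - so x)" for J \<omega>
    define e where "e J \<omega> = norm2 lborel (a J \<omega>)" for J \<omega>
    have good: "AE \<omega> in M. \<forall>K\<in>{1..V}. shat K \<omega> \<in> S \<and>
        (\<forall>t\<in>S. ?ip (shat K \<omega>) t = emp_mean X (B K) \<omega> t)"
      using shat
    proof eventually_elim
      case (elim \<omega>)
      show ?case
      proof (intro ballI conjI)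
        fix K t assume K: "K \<in> {1..V}"
        then have min: "is_arg_min (\<lambda>t. emp_mean X (B K) \<omega> (contrast lborel t)) (\<lambda>t. t \<in> S) (shat K \<omega>)"
          using elim by blast
        show "shat K \<omega> \<in> S" using min by (simp add: is_arg_min_def)
        assume t: "t \<in> S"
        show "?ip (shat K \<omega>) t = emp_mean X (B K) \<omega> t"
          by (rule emp_contrast_minimizer(2)[OF S B(2,3)[OF K] min t])
      qed
    qed
    have e_Z: "ennreal ((e J \<omega>)\<^sup>2) = Z J \<omega>"
      if \<omega>: "\<forall>K\<in>{1..V}. shat K \<omega> \<in> S \<and> (\<forall>t\<in>S. ?ip (shat K \<omega>) t = emp_mean X (B K) \<omega> t)"
        and J: "J \<in> {1..V}" for \<omega> J
    proof -
      have sh: "shat J \<omega> \<in> S" using \<omega> J by blast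
      have "a J \<omega> \<in> S" unfolding a_def by (rule linear_space_diff[OF S(2) sh so])
      then have "(\<lambda>k. (?ip (a J \<omega>) (\<psi> k))\<^sup>2) sums (e J \<omega>)\<^sup>2"
        unfolding e_def norm2_power2 by (rule total)
      moreover have "?ip (a J \<omega>) (\<psi> k) = emp_mean X (B J) \<omega> (\<psi> k) - ?ip s (\<psi> k)" for k
        using \<omega> J \<psi>[of k] unfolding a_def
        by (simp add: ip_diff_left[OF SL[OF \<psi>] SL[OF sh] SL[OF so]] so_proj)
      ultimately show ?thesis unfolding Z_def by (subst suminf_ennreal_eq) auto
    qed
    \<comment> \<open>Pythagoras: the estimator minus \<open>so\<close> lies in \<open>S\<close>, to
      which \<open>so - s\<close> is orthogonal.\<close>
    have risk: "(norm2 lborel (\<lambda>x. shat (Kstar \<omega>) \<omega> x - s x))\<^sup>2 =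
        (norm2 lborel (\<lambda>x. so x - s x))\<^sup>2 + (e (Kstar \<omega>) \<omega>)\<^sup>2"
      if sh: "shat (Kstar \<omega>) \<omega> \<in> S" for \<omega>
    proof -
      have aS: "a (Kstar \<omega>) \<omega> \<in> S" unfolding a_def by (rule linear_space_diff[OF S(2) sh so])
      have d: "(\<lambda>x. so x - s x) \<in> L2 lborel" using SL[OF so] sL by (rule L2_diff)
      have "?ip (a (Kstar \<omega>) \<omega>) (\<lambda>x. so x - s x) = 0"
        using SL[OF aS] SL[OF so] sL so_proj[OF aS]
        by (simp add: ip_diff_right ip_commute[of lborel "a (Kstar \<omega>) \<omega>" s]
            ip_commute[of lborel "a (Kstar \<omega>) \<omega>" so])
      moreover have "(\<lambda>x. shat (Kstar \<omega>) \<omega> x - s x) = (\<lambda>x. a (Kstar \<omega>) \<omega> x + (so x - s x))"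
        by (simp add: a_def)
      ultimately show ?thesis
        by (simp add: norm2_power2 ip_add_self[OF SL[OF aS] d] e_def)
    qed
    have bad_iff: "\<omega> \<in> ?bad \<longleftrightarrow> \<omega> \<in> space M \<and> (e (Kstar \<omega>) \<omega>)\<^sup>2 > L5_const * D * (real V / real n)"
      if "shat (Kstar \<omega>) \<omega> \<in> S" for \<omega>
      using p risk[OF that] by (simp add: D_def norm2_power2)
    show ?thesis
    \<comment> \<open>For \<open>D = 0\<close> there is no scale to divide by; then all errors
      vanish almost surely.\<close>
    proof (cases "D = 0")
      case True
      have "AE \<omega> in M. \<forall>J\<in>{1..V}. Z J \<omega> = 0"
      proof (rule AE_finite_allI)
        fix J assume J: "J \<in> {1..V}"
        have "Z J \<in> borel_measurable M" using indepZ J by (simp add: indep_vars_def2)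
        moreover have "(\<integral>\<^sup>+\<omega>. Z J \<omega> \<partial>M) = 0" using Z_le[OF J] True by simp
        ultimately show "AE \<omega> in M. Z J \<omega> = 0" by (simp add: nn_integral_0_iff_AE)
      qed simp
      then have "AE \<omega> in M. \<omega> \<in> ?bad \<longrightarrow> \<omega> \<in> {}"
        using good
      proof eventually_elim
        case (elim \<omega>)
        show ?case
        proof
          assume bad: "\<omega> \<in> ?bad"
          then have K: "Kstar \<omega> \<in> {1..V}" using Kstar[of \<omega>] by (auto simp: is_arg_min_def)
          have "(e (Kstar \<omega>) \<omega>)\<^sup>2 > 0"
            using bad_iff[of \<omega>] bad elim(2) K True by auto
          moreover have "ennreal ((e (Kstar \<omega>) \<omega>)\<^sup>2) = 0" using e_Z[OF elim(2) K] elim(1) K by simp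
          ultimately show "\<omega> \<in> {}" by simp
        qed
      qed
      then have "outer_measure_of M ?bad \<le> emeasure M {}" by (rule outer_measure_of_le_AE) auto
      also have "\<dots> \<le> ennreal (2 * \<delta>)" by simp
      finally show ?thesis .
    next
      case False
      \<comment> \<open>In units of \<open>u\<close> the failure threshold is
        \<open>L5_const\<close>, and \<open>c * (e J \<omega>)\<^sup>2\<close> is
        \<open>3/4 * (e J \<omega> / u)\<^sup>2\<close>.\<close>
      define u where "u = sqrt (D * (real V / real n))"
      have u: "0 < u" "u\<^sup>2 = D * (real V / real n)" using False D0 V n by (auto simp: u_def)
      define G where "G = (2 * exp (1/2)) ^ V / (2::real)"
      define c where "c = 3/4 / u\<^sup>2"
      have G: "0 < G" by (simp add: G_def)
      have c: "0 \<le> c" by (simp add: c_def)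
      define E where "E = {\<omega>\<in>space M. ennreal G \<le> (\<Prod>J\<in>{1..V}. 1 + ennreal c * Z J \<omega>)}"
      have mJ: "0 \<le> D / real (card (B J))" for J using D0 by simp
      note markov = prob_prod_affine_ge[OF indepZ finite_atLeastAtMost Z_le mJ c G, folded E_def]
      have "AE \<omega> in M. \<omega> \<in> ?bad \<longrightarrow> \<omega> \<in> E"
        using good
      proof eventually_elim
        case (elim \<omega>)
        show ?case
        proof
          assume bad: "\<omega> \<in> ?bad"
          then have \<omega>: "\<omega> \<in> space M" by simp
          have K: "Kstar \<omega> \<in> {1..V}" using Kstar[OF \<omega>] by (simp add: is_arg_min_def)
          have sh: "shat K \<omega> \<in> S" if "K \<in> {1..V}" for K using elim that by blast
          have sel: "e (Kstar \<omega>) \<omega> \<le> (1 + sqrt 2) * \<eta> + sqrt 2 * e Ko \<omega>"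
            if Ko: "Ko \<in> {1..V}" and few: "2 * card {J \<in> {1..V}. \<eta> < e J \<omega>} + 2 < card {1..V}" for Ko \<eta>
          proof (rule minmax_median_selection_bound[where v = "\<lambda>K K' J. emp_mean X (B J) \<omega>
                (\<lambda>x. contrast lborel (shat K \<omega>) x - contrast lborel (shat K' \<omega>) x)"
                and Pb = "\<lambda>K K'. Pbar K K' \<omega>", OF _ _ _ _ Kstar[OF \<omega>] Ko few])
            show "is_median ({1..V} - {K, K'}) (\<lambda>J. emp_mean X (B J) \<omega>
                (\<lambda>x. contrast lborel (shat K \<omega>) x - contrast lborel (shat K' \<omega>) x)) (Pbar K K' \<omega>)"
              if "K \<in> {1..V}" "K' \<in> {1..V}" for K K' using Pbar[OF \<omega> that] .
            show "0 \<le> e K \<omega>" for K by (simp add: e_def norm2_nonneg)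
            fix K K' J assume KJ: "K \<in> {1..V}" "K' \<in> {1..V}" "J \<in> {1..V}"
            \<comment> \<open>The normal equations of block \<open>J\<close>, tested against the
              estimator of another block \<open>L\<close>.\<close>
            have emp: "emp_mean X (B J) \<omega> (shat L \<omega>) = ?ip (shat J \<omega>) (shat L \<omega>)"
              if "L \<in> {1..V}" for L
              using elim KJ(3) sh[OF that] by simp
            show "\<bar>emp_mean X (B J) \<omega> (\<lambda>x. contrast lborel (shat K \<omega>) x - contrast lborel (shat K' \<omega>) x)
                - ((e K \<omega>)\<^sup>2 - (e K' \<omega>)\<^sup>2)\<bar> \<le> 2 * e J \<omega> * (e K \<omega> + e K' \<omega>)"
              unfolding emp_mean_diff emp_mean_contrast[OF B(2,3)[OF KJ(3)]] emp[OF KJ(1)] emp[OF KJ(2)]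
                e_def a_def
              by (intro abs_contrast_diff_le SL sh so KJ)
          qed simp
          have "G \<le> (\<Prod>J\<in>{1..V}. 1 + 3/4 * (e J \<omega> / u)\<^sup>2)"
          proof -
            have "(2 * exp (1/2)) ^ card {1..V} / 2 \<le> (\<Prod>J\<in>{1..V}. 1 + 3/4 * (e J \<omega> / u)\<^sup>2)"
            proof (rule selection_failure_prod_lower[OF _ _ _ K])
              show "0 \<le> e J \<omega> / u" for J using u by (simp add: e_def norm2_nonneg)
              have "L5_const * u\<^sup>2 < (e (Kstar \<omega>) \<omega>)\<^sup>2"
                using bad bad_iff[OF sh[OF K]] u(2) by (simp add: mult.assoc)
              then have "L5_const < (e (Kstar \<omega>) \<omega>)\<^sup>2 / u\<^sup>2" using u(1) by (simp add: pos_less_divide_eq)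
              then show "80.66 \<le> (e (Kstar \<omega>) \<omega> / u)\<^sup>2" using L5(2) unfolding power_divide by linarith
              fix Ko \<eta> assume Ko: "Ko \<in> {1..V}"
                and few: "2 * card {J \<in> {1..V}. \<eta> < e J \<omega> / u} + 2 < card {1..V}"
              \<comment> \<open>The selection bound is homogeneous in the errors and the threshold,
                so it survives division by \<open>u\<close>.\<close>
              have "{J \<in> {1..V}. \<eta> < e J \<omega> / u} = {J \<in> {1..V}. \<eta> * u < e J \<omega>}"
                using u(1) by (simp add: pos_less_divide_eq)
              then have "e (Kstar \<omega>) \<omega> \<le> (1 + sqrt 2) * (\<eta> * u) + sqrt 2 * e Ko \<omega>"
                using few by (intro sel[OF Ko]) simp
              then show "e (Kstar \<omega>) \<omega> / u \<le> (1 + sqrt 2) * \<eta> + sqrt 2 * (e Ko \<omega> / u)"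
                using u(1) by (simp add: field_simps)
            qed (use V8 in auto)
            then show ?thesis by (simp add: G_def)
          qed
          then have "ennreal G \<le> ennreal (\<Prod>J\<in>{1..V}. 1 + 3/4 * (e J \<omega> / u)\<^sup>2)" by (rule ennreal_leI)
          also have "\<dots> = (\<Prod>J\<in>{1..V}. ennreal (1 + 3/4 * (e J \<omega> / u)\<^sup>2))"
            by (rule prod_ennreal[symmetric]) simp
          also have "\<dots> = (\<Prod>J\<in>{1..V}. 1 + ennreal c * Z J \<omega>)"
          proof (rule prod.cong[OF refl])
            fix J assume J: "J \<in> {1..V}"
            have "ennreal (1 + 3/4 * (e J \<omega> / u)\<^sup>2) = 1 + ennreal (c * (e J \<omega>)\<^sup>2)"
              by (simp add: c_def power_divide)
            also have "ennreal (c * (e J \<omega>)\<^sup>2) = ennreal c * ennreal ((e J \<omega>)\<^sup>2)"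
              using c by (simp add: ennreal_mult)
            finally show "ennreal (1 + 3/4 * (e J \<omega> / u)\<^sup>2) = 1 + ennreal c * Z J \<omega>"
              using e_Z[OF elim J] by simp
          qed
          finally show "\<omega> \<in> E" using \<omega> by (simp add: E_def)
        qed
      qed
      then have "outer_measure_of M ?bad \<le> emeasure M E"
        by (rule outer_measure_of_le_AE) (use markov(1) in auto)
      also have "\<dots> \<le> ennreal ((\<Prod>J\<in>{1..V}. 1 + c * (D / real (card (B J)))) / G)"
        by (rule markov(2))
      also have "\<dots> \<le> ennreal (2 * \<delta>)"
      proof (rule ennreal_leI)
        \<comment> \<open>\<open>D\<close> cancels, and what remains depends on the block sizes
          only.\<close>
        have "c * (D / real (card (B J))) = 3/4 * (real n / (real V * real (card (B J))))" for J
          using u False V n by (simp add: c_def)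
        then have "(\<Prod>J\<in>{1..V}. 1 + c * (D / real (card (B J)))) / G \<le> 2 ^ V / G"
          using regular_partition_prod_le[OF reg V assms(12)] G by (intro divide_right_mono) auto
        also have "\<dots> = 2 * exp (- (real V / 2))"
          by (simp add: G_def power_mult_distrib exp_minus field_simps flip: exp_of_nat_mult)
        also have "\<dots> \<le> 2 * \<delta>"
        proof -
          have "ln (\<delta> powi (- 2)) = - 2 * ln \<delta>"
            using assms(9) by (simp add: power_int_minus ln_inverse ln_realpow)
          moreover have "ln (\<delta> powi (- 2)) \<le> real V"
            using assms(11) le_of_int_ceiling[of "ln (\<delta> powi (- 2))"] by linarith
          ultimately have "exp (- (real V / 2)) \<le> exp (ln \<delta>)" by simp
          then show ?thesis using assms(9) by simp
        qed
        finally show "(\<Prod>J\<in>{1..V}. 1 + c * (D / real (card (B J)))) / G \<le> 2 * \<delta>" .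
      qed
      finally show ?thesis .
    qed
  qed
qed

end
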